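(* There is an absolute constant $c>0$ such that for every finite set $P\subset\mathbb{R}^2$ with $|P|\ge2$, $$\bigl|\{p\cdot q:p,q\in P,\ p\ne q\}\bigr|\ \ge\ c\,|P|^{199/295}.$$
   Context: $p\cdot q$ is the standard inner product on $\mathbb{R}^2$. *)

theory Defs
  imports "HOL-Analysis.Analysis"
begin

end

theory Submission
  imports Defs
begin

text \<open>
  In a quadrant the points are \<open>a(1, x)\<close> with \<open>a > 0\<close> and \<open>x \<ge> 0\<close>, and their products are
  \<open>ab(1 + xy)\<close>. Let \<open>N\<close> be the number of points, \<open>K\<close> the number of products and \<open>n(m)\<close> the
  number of lines through the origin with at least \<open>m\<close> points.

  Each of the \<open>n(1)\<close> directions covers the points by about \<open>K\<close> parallel lines, so the crossing
  lemma gives the Szemeredi--Trotter type bound \<open>n(1) N \<lesssim> K\<^sup>2\<close>.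

  For two fixed slopes \<open>z, z'\<close> consider the values \<open>y\<close> of the alternating products
  \<open>(1 + z x\<^sub>1) / (1 + x\<^sub>1 w\<^sub>1) \<cdot> (1 + w\<^sub>1 x\<^sub>2) / (1 + x\<^sub>2 w\<^sub>2) \<cdot> \<dots> / (1 + x\<^sub>4 z')\<close> along paths with seven
  inner vertices of richness \<open>m\<close>. Distributing scalars over the inner vertices writes every \<open>y\<close>
  in \<open>m\<^sup>7\<close> ways by eight products, so there are at most \<open>K\<^sup>8 / m\<^sup>7\<close> values. Conversely there are at
  least of order \<open>n(m)\<close> to the \<open>5/2\<close>: the numbers \<open>(1 + z x) / (1 + z' x)\<close> cut a line into
  about \<open>n(m)\<close> gaps, and into each gap one squeezes \<open>n(m)\<close> to the \<open>3/2\<close> values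
  \<open>g(w) g(w'') / g(w')\<close> with \<open>g(w) = (1 + w q) / (1 + w x)\<close>, because for two choices of \<open>q\<close> the
  consecutive ratios of \<open>g\<close> cannot both take few values.

  Hence \<open>n(m)^5 m^14 \<lesssim> K^16\<close>. With the first bound, summing over \<open>m\<close> yields \<open>N^23 \<lesssim> K^34\<close>, and
  \<open>23/34 > 199/295\<close>.
\<close>

section \<open>Straight-line graphs and the crossing lemma\<close>

definition slope :: "(real \<times> real) \<times> (real \<times> real) \<Rightarrow> real" where
  "slope e = (snd (snd e) - snd (fst e)) / (fst (snd e) - fst (fst e))"

definition ht :: "(real \<times> real) \<times> (real \<times> real) \<Rightarrow> real \<Rightarrow> real" where
  "ht e x = snd (fst e) + slope e * (x - fst (fst e))"

text \<open>The open x-range is used so that edges sharing only an endpoint do not count as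
  crossing.\<close>

definition alive :: "(real \<times> real) \<times> (real \<times> real) \<Rightarrow> real \<Rightarrow> bool" where
  "alive e x \<longleftrightarrow> fst (fst e) < x \<and> x < fst (snd e)"

definition crossing :: "(real \<times> real) \<times> (real \<times> real) \<Rightarrow> (real \<times> real) \<times> (real \<times> real) \<Rightarrow> bool" where
  "crossing e f \<longleftrightarrow> e \<noteq> f \<and> (\<exists>x. alive e x \<and> alive f x \<and> ht e x = ht f x)"

lemma ex_argmin:
  fixes f :: "'a \<Rightarrow> 'b::linorder"
  assumes "finite S" "S \<noteq> {}"
  obtains x where "x \<in> S" "\<And>y. y \<in> S \<Longrightarrow> f x \<le> f y"
proof -
  have "Min (f ` S) \<in> f ` S" using assms by simp
  then obtain x where "x \<in> S" "f x = Min (f ` S)" by auto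
  with assms show ?thesis by (intro that[of x]) auto
qed

lemma ht_left [simp]: "ht e (fst (fst e)) = snd (fst e)"
  by (simp add: ht_def)

lemma ht_right [simp]: "fst (fst e) < fst (snd e) \<Longrightarrow> ht e (fst (snd e)) = snd (snd e)"
  by (simp add: ht_def slope_def)

lemma ht_less_same_start:
  assumes "fst e = fst f" "fst (fst e) < x"
  shows "ht e x < ht f x \<longleftrightarrow> slope e < slope f"
  using assms by (simp add: ht_def)

lemma ht_cross_between:
  assumes "ht e x < ht f x" "ht f y < ht e y"
  shows "\<exists>t. min x y < t \<and> t < max x y \<and> ht e t = ht f t"
proof -
  define d where "d = (\<lambda>t. ht f t - ht e t)"
  have c: "continuous_on A d" for A
    unfolding d_def ht_def by (intro continuous_intros)
  have "x \<noteq> y" using assms by auto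
  then consider "x < y" | "y < x" by linarith
  then obtain t where t: "min x y \<le> t" "t \<le> max x y" "d t = 0"
  proof cases
    case 1
    then show ?thesis using IVT2'[of d y 0 x] assms c that unfolding d_def by force
  next
    case 2
    then show ?thesis using IVT'[of d y 0 x] assms c that unfolding d_def by force
  qed
  moreover have "t \<noteq> x" "t \<noteq> y" using assms t(3) by (auto simp: d_def)
  ultimately show ?thesis by (intro exI[of _ t]) (auto simp: d_def min_def max_def split: if_splits)
qed

locale plane_graph =
  fixes V :: "(real \<times> real) set" and E :: "((real \<times> real) \<times> (real \<times> real)) set"
  assumes finite_V: "finite V"
    and fst_V: "e \<in> E \<Longrightarrow> fst e \<in> V"
    and snd_V: "e \<in> E \<Longrightarrow> snd e \<in> V"
    and left_right: "e \<in> E \<Longrightarrow> fst (fst e) < fst (snd e)"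
    and vertex_free: "e \<in> E \<Longrightarrow> v \<in> V \<Longrightarrow> alive e (fst v) \<Longrightarrow> ht e (fst v) \<noteq> snd v"
begin

lemma E_subset: "E \<subseteq> V \<times> V"
  using fst_V snd_V by (metis mem_Times_iff subsetI)

lemma finite_E: "finite E"
  using E_subset finite_V by (meson finite_SigmaI finite_subset)

text \<open>If two overlapping collinear edges had different endpoints, an endpoint of one would lie
  in the interior of the other, which \<open>vertex_free\<close> forbids.\<close>

lemma same_line:
  assumes e: "e \<in> E" and f: "f \<in> E" and "slope e = slope f" "ht e x = ht f x"
    and al: "alive e x" "alive f x"
  shows "e = f"
proof -
  have h: "ht e y = ht f y" for y
    using assms(3,4) by (simp add: ht_def algebra_simps)
  note lr = left_right[OF e] left_right[OF f]
  have "\<not> fst (snd e) < fst (snd f)"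
    using vertex_free[OF f snd_V[OF e]] h[of "fst (snd e)"] lr al by (auto simp: alive_def)
  moreover have "\<not> fst (snd f) < fst (snd e)"
    using vertex_free[OF e snd_V[OF f]] h[of "fst (snd f)"] lr al by (auto simp: alive_def)
  moreover have "\<not> fst (fst e) < fst (fst f)"
    using vertex_free[OF e fst_V[OF f]] h[of "fst (fst f)"] al by (auto simp: alive_def)
  moreover have "\<not> fst (fst f) < fst (fst e)"
    using vertex_free[OF f fst_V[OF e]] h[of "fst (fst e)"] al by (auto simp: alive_def)
  ultimately have x: "fst (snd e) = fst (snd f)" "fst (fst e) = fst (fst f)" by linarith+
  then have "snd (snd e) = snd (snd f)" "snd (fst e) = snd (fst f)"
    using ht_right[OF lr(1)] ht_right[OF lr(2)] h[of "fst (snd e)"]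
      ht_left[of e] ht_left[of f] h[of "fst (fst e)"] by auto
  with x show ?thesis by (simp add: prod_eq_iff)
qed

lemma same_start_same_slope:
  assumes "e \<in> E" "f \<in> E" "fst e = fst f" "slope e = slope f"
  shows "e = f"
proof -
  have "fst (fst e) < min (fst (snd e)) (fst (snd f))"
    using left_right[OF assms(1)] left_right[OF assms(2)] assms(3) by simp
  then obtain x where x: "fst (fst e) < x" "x < min (fst (snd e)) (fst (snd f))"
    using dense by blast
  show ?thesis
    by (rule same_line[OF assms(1,2,4), of x]) (use x assms in \<open>auto simp: alive_def ht_def\<close>)
qed

lemma crossing_slope_neq:
  assumes "e \<in> E" "f \<in> E" "crossing e f"
  shows "slope e \<noteq> slope f"
  using same_line assms unfolding crossing_def by blast

text \<open>The slopes differ, so the two lines meet only at the crossing, which is interior to both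
  edges; hence no endpoint is shared. Sampling uses this: a crossing survives only if four distinct
  vertices do.\<close>

lemma crossing_disjoint:
  assumes "e \<in> E" "f \<in> E" "crossing e f"
  shows "card {fst e, snd e, fst f, snd f} = 4"
proof -
  obtain x where x: "alive e x" "alive f x" "ht e x = ht f x"
    using assms(3) by (auto simp: crossing_def)
  note sl = crossing_slope_neq[OF assms]
  note lr = left_right[OF assms(1)] left_right[OF assms(2)]
  have *: "ht e y = ht f y \<longleftrightarrow> y = x" for y
  proof -
    have "ht e y - ht f y = (slope e - slope f) * (y - x) + (ht e x - ht f x)"
      by (simp add: ht_def algebra_simps)
    then show ?thesis using sl x(3) by auto
  qed
  have "fst e \<noteq> fst f" "snd e \<noteq> snd f"
    using *[of "fst (fst e)"] *[of "fst (snd e)"] ht_left[of e] ht_left[of f]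
      ht_right[OF lr(1)] ht_right[OF lr(2)] x by (auto simp: alive_def)
  moreover have "fst e \<noteq> snd f" "snd e \<noteq> fst f" "fst e \<noteq> snd e" "fst f \<noteq> snd f"
    using x lr by (auto simp: alive_def)
  ultimately show ?thesis by auto
qed

section \<open>Wedges and the linear edge bound for crossing-free graphs\<close>

definition in_wedge where
  "in_wedge e f v \<longleftrightarrow> fst (fst e) < fst v \<and> fst v \<le> fst (snd e) \<and> fst v \<le> fst (snd f)
     \<and> ht e (fst v) \<le> snd v \<and> snd v \<le> ht f (fst v)"

text \<open>Here \<^term>\<open>f\<close> is the next edge above \<^term>\<open>e\<close> at their common left endpoint and
  \<^term>\<open>w\<close> is a leftmost vertex between them. No edge enters the wedge before \<^term>\<open>w\<close>, so
  \<^term>\<open>w\<close>, together with the information whether \<^term>\<open>w\<close> lies on \<^term>\<open>e\<close>,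
  determines \<^term>\<open>e\<close>. This replaces Euler's formula in the linear bound on the number of
  edges.\<close>

definition first_in_wedge where
  "first_in_wedge e f w \<longleftrightarrow> e \<in> E \<and> f \<in> E \<and> fst f = fst e \<and> slope e < slope f
     \<and> (\<forall>g\<in>E. fst g = fst e \<longrightarrow> \<not> (slope e < slope g \<and> slope g < slope f))
     \<and> w \<in> V \<and> in_wedge e f w \<and> (\<forall>v\<in>V. in_wedge e f v \<longrightarrow> fst w \<le> fst v)"

text \<open>Take for \<open>f\<close> the edge of least slope above \<open>e\<close>. Whichever of
  the two edges ends first has its right endpoint in the wedge, so the wedge contains a vertex and
  hence a leftmost one.\<close>

lemma ex_first_in_wedge:
  assumes e: "e \<in> E" and "{f \<in> E. fst f = fst e \<and> slope e < slope f} \<noteq> {}"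
  shows "\<exists>f w. first_in_wedge e f w"
proof -
  let ?U = "{f \<in> E. fst f = fst e \<and> slope e < slope f}"
  have fin: "finite ?U" using finite_E by simp
  obtain f where f: "f \<in> ?U" "\<And>g. g \<in> ?U \<Longrightarrow> slope f \<le> slope g"
    using ex_argmin[OF fin assms(2), of slope] by blast
  let ?W = "{v \<in> V. in_wedge e f v}"
  have fs: "f \<in> E" "fst f = fst e" "slope e < slope f" using f(1) by auto
  note lr = left_right[OF e] left_right[OF fs(1)]
  have lt: "ht e x < ht f x" if "fst (fst e) < x" for x
    using ht_less_same_start[of e f x] that fs by simp
  have "?W \<noteq> {}"
  proof (cases "fst (snd e) \<le> fst (snd f)")
    case True
    then have "in_wedge e f (snd e)"
      using lr lt[OF lr(1)] by (auto simp: in_wedge_def)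
    then show ?thesis using snd_V[OF e] by blast
  next
    case False
    then have "in_wedge e f (snd f)"
      using lr fs(2) lt[of "fst (snd f)"] by (auto simp: in_wedge_def)
    then show ?thesis using snd_V[OF fs(1)] by blast
  qed
  moreover have "finite ?W" using finite_V by simp
  ultimately obtain w where w: "w \<in> ?W" "\<And>v. v \<in> ?W \<Longrightarrow> fst w \<le> fst v"
    using ex_argmin[of ?W fst] by metis
  have "first_in_wedge e f w"
    unfolding first_in_wedge_def using e f w by fastforce
  then show ?thesis by blast
qed

end

locale plane_embedded_graph = plane_graph +
  assumes no_crossing: "e \<in> E \<Longrightarrow> f \<in> E \<Longrightarrow> \<not> crossing e f"
begin

lemma ht_neq: "e \<in> E \<Longrightarrow> f \<in> E \<Longrightarrow> e \<noteq> f \<Longrightarrow> alive e x \<Longrightarrow> alive f x \<Longrightarrow> ht e x \<noteq> ht f x"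
  using no_crossing[of e f] unfolding crossing_def by blast

text \<open>By the intermediate value theorem, a reversal of the vertical order would produce a
  crossing.\<close>

lemma ht_order_preserved:
  assumes "e \<in> E" "f \<in> E" "alive e x" "alive f x" "ht e x < ht f x"
    and "fst (fst e) \<le> y" "fst (fst f) \<le> y" "y \<le> fst (snd e)" "y \<le> fst (snd f)"
  shows "ht e y \<le> ht f y"
proof (rule ccontr)
  assume "\<not> ?thesis"
  then obtain t where t: "min x y < t" "t < max x y" "ht e t = ht f t"
    using ht_cross_between[of e x f y] assms(5) by auto
  have "alive e t" "alive f t"
    using t assms by (auto simp: alive_def min_def max_def split: if_splits)
  moreover have "e \<noteq> f" using assms(5) by auto
  ultimately show False using ht_neq assms(1,2) t(3) by blast
qed

text \<open>Follow \<open>g\<close> to the left inside the wedge. It starts there, giving a vertex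
  before \<open>w\<close>; or it passes through the apex, against \<open>vertex_free\<close>; or it
  starts at the apex with a slope strictly between those of the consecutive edges \<open>e\<close>
  and \<open>f\<close>.\<close>

lemma no_intruder:
  assumes fw: "first_in_wedge e f w" and g: "g \<in> E" "alive g x"
    and x: "fst (fst e) < x" "x < fst w"
    and le: "ht e x \<le> ht g x" "ht g x \<le> ht f x"
  shows "g = e \<or> g = f"
proof (rule ccontr)
  assume n: "\<not> ?thesis"
  have e: "e \<in> E" and f: "f \<in> E" and ef: "fst f = fst e"
    and cons: "\<And>h. h \<in> E \<Longrightarrow> fst h = fst e \<Longrightarrow> \<not> (slope e < slope h \<and> slope h < slope f)"
    and w: "in_wedge e f w" and mn: "\<And>v. v \<in> V \<Longrightarrow> in_wedge e f v \<Longrightarrow> fst w \<le> fst v"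
    using fw by (auto simp: first_in_wedge_def)
  have ae: "alive e x" and af: "alive f x"
    using w x ef by (auto simp: alive_def in_wedge_def)
  have s: "ht e x < ht g x" "ht g x < ht f x"
    using ht_neq[OF e g(1) _ ae g(2)] ht_neq[OF f g(1) _ af g(2)] n le by force+
  have between: "ht e y \<le> ht g y" "ht g y \<le> ht f y"
    if "fst (fst e) \<le> y" "fst (fst g) \<le> y" "y \<le> x" for y
    using ht_order_preserved[OF e g(1) ae g(2) s(1), of y]
      ht_order_preserved[OF g(1) f g(2) af s(2), of y] that ae af g(2) ef
    by (auto simp: alive_def)
  consider "fst (fst e) < fst (fst g)" | "fst (fst g) < fst (fst e)" | "fst (fst g) = fst (fst e)"
    by linarith
  then show False
  proof cases
    case 1
    then have "in_wedge e f (fst g)"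
      using between[of "fst (fst g)"] g(2) ae af by (auto simp: in_wedge_def alive_def)
    then show False using mn[OF fst_V[OF g(1)]] g(2) x by (auto simp: alive_def)
  next
    case 2
    then have "ht g (fst (fst e)) = snd (fst e)"
      using between[of "fst (fst e)"] x(1) ht_left[of e] ht_left[of f] ef by auto
    moreover have "alive g (fst (fst e))" using 2 g(2) x(1) by (auto simp: alive_def)
    ultimately show False using vertex_free[OF g(1) fst_V[OF e]] by blast
  next
    case 3
    then have "snd (fst g) = snd (fst e)"
      using between[of "fst (fst e)"] x(1) ht_left[of e] ht_left[of f] ht_left[of g] ef by auto
    then have "fst g = fst e" using 3 by (simp add: prod_eq_iff)
    then show False
      using cons[OF g(1)] s ht_less_same_start[of e g x] ht_less_same_start[of g f x] x(1) ef by auto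
  qed
qed

text \<open>Whether \<open>w\<close> lies on both lower edges or on neither, \<open>e'\<close> is
  strictly below \<open>f\<close> at \<open>w\<close>. It is therefore between \<open>e\<close> and
  \<open>f\<close> already at \<open>x\<close>, and \<open>no_intruder\<close> leaves only
  \<open>e' = e\<close>.\<close>

lemma wedge_determined_le:
  assumes fw: "first_in_wedge e f w" "first_in_wedge e' f' w"
    and x: "fst (fst e) < x" "fst (fst e') < x" "x < fst w"
    and le: "ht e x \<le> ht e' x"
    and kind: "ht e (fst w) = snd w \<longleftrightarrow> ht e' (fst w) = snd w"
  shows "e = e'"
proof -
  have e: "e \<in> E" "f \<in> E" "e' \<in> E" "fst f = fst e"  "slope e < slope f"
    and w: "in_wedge e f w" "in_wedge e' f' w"
    using fw by (auto simp: first_in_wedge_def)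
  have ae: "alive e' x" "alive f x"
    using w x e(4) by (auto simp: alive_def in_wedge_def)
  have lt: "ht e (fst w) < ht f (fst w)"
    using ht_less_same_start[of e f "fst w"] w e by (auto simp: in_wedge_def)
  have h: "ht e' (fst w) < ht f (fst w)"
    using lt kind w by (cases "ht e (fst w) = snd w") (auto simp: in_wedge_def)
  have "ht e' x \<le> ht f x"
  proof (rule ccontr)
    assume "\<not> ?thesis"
    then have "ht f (fst w) \<le> ht e' (fst w)"
      using ht_order_preserved[OF e(2,3) ae(2,1), of "fst w"] w e(4) by (auto simp: in_wedge_def)
    then show False using h by simp
  qed
  then have "e' = e \<or> e' = f" using no_intruder[OF fw(1) e(3) ae(1) x(1,3) le] by simp
  then show ?thesis using h by auto
qed

lemma wedge_determined:
  assumes fw: "first_in_wedge e f w" "first_in_wedge e' f' w"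
    and kind: "ht e (fst w) = snd w \<longleftrightarrow> ht e' (fst w) = snd w"
  shows "e = e'"
proof -
  have "max (fst (fst e)) (fst (fst e')) < fst w"
    using fw by (auto simp: first_in_wedge_def in_wedge_def)
  then obtain x where "max (fst (fst e)) (fst (fst e')) < x" "x < fst w"
    using dense by blast
  then show ?thesis
    using wedge_determined_le[OF fw, of x] wedge_determined_le[OF fw(2,1), of x] kind
    by (cases "ht e x \<le> ht e' x") auto
qed

text \<open>Each vertex is the left endpoint of at most one topmost edge (the set
  \<open>?T\<close>). Every other edge is determined by its first wedge vertex and one bit, which
  accounts for the remaining \<open>2 * card V\<close>.\<close>

theorem card_edges_le: "card E \<le> 3 * card V"
proof -
  let ?up = "\<lambda>e. {f \<in> E. fst f = fst e \<and> slope e < slope f}"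
  let ?T = "{e \<in> E. ?up e = {}}" and ?R = "{e \<in> E. ?up e \<noteq> {}}"
  have "inj_on fst ?T"
  proof (rule inj_onI)
    fix e f assume ef: "e \<in> ?T" "f \<in> ?T" "fst e = fst f"
    have n: "\<not> slope a < slope b" if a: "a \<in> ?T" and b: "b \<in> ?T" and ab: "fst a = fst b" for a b
    proof
      assume "slope a < slope b"
      then have "b \<in> ?up a" using b ab by simp
      moreover have "?up a = {}" using a by simp
      ultimately show False by blast
    qed
    have "slope e = slope f" using n[OF ef] n[OF ef(2,1) ef(3)[symmetric]] by linarith
    then show "e = f" using ef same_start_same_slope by blast
  qed
  then have T: "card ?T \<le> card V"
    by (rule card_inj_on_le) (use fst_V finite_V in auto)
  have "\<forall>e\<in>?R. \<exists>w f. first_in_wedge e f w" using ex_first_in_wedge by fast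
  from bchoice[OF this] obtain W where W: "\<forall>e\<in>?R. \<exists>f. first_in_wedge e f (W e)" ..
  let ?c = "\<lambda>e. (W e, ht e (fst (W e)) = snd (W e))"
  have "inj_on ?c ?R"
  proof (rule inj_onI)
    fix e e' assume a: "e \<in> ?R" "e' \<in> ?R" "?c e = ?c e'"
    obtain f f' where ff: "first_in_wedge e f (W e)" "first_in_wedge e' f' (W e)"
      using bspec[OF W a(1)] bspec[OF W a(2)] a(3) by auto
    show "e = e'" by (rule wedge_determined[OF ff]) (use a(3) in auto)
  qed
  moreover have "?c ` ?R \<subseteq> V \<times> UNIV"
  proof
    fix c assume "c \<in> ?c ` ?R"
    then obtain e where e: "e \<in> ?R" "c = ?c e" by blast
    then show "c \<in> V \<times> UNIV" using bspec[OF W e(1)] by (auto simp: first_in_wedge_def)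
  qed
  moreover have "finite (V \<times> (UNIV :: bool set))" using finite_V by simp
  ultimately have "card ?R \<le> card (V \<times> (UNIV :: bool set))"
    by (rule card_inj_on_le)
  also have "\<dots> = 2 * card V" by (simp add: card_cartesian_product)
  finally have R: "card ?R \<le> 2 * card V" .
  have "card E = card (?T \<union> ?R)" by (rule arg_cong[of _ _ card]) blast
  also have "\<dots> \<le> card ?T + card ?R" by (rule card_Un_le)
  finally show ?thesis using T R by simp
qed

end

section \<open>Vertex sampling and the crossing lemma\<close>

text \<open>Keeping colour 0 of a uniformly random colouring selects vertices independently with
  probability 1/k. Counting colourings replaces the expectations.\<close>

definition zero_on :: "'a set \<Rightarrow> nat \<Rightarrow> 'a set \<Rightarrow> ('a \<Rightarrow> nat) set" where
  "zero_on V k T = {c \<in> V \<rightarrow>\<^sub>E {..<k}. \<forall>v\<in>T. c v = 0}"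

lemma card_zero_on:
  assumes "finite V" "T \<subseteq> V" "0 < k"
  shows "card (zero_on V k T) = k ^ (card V - card T)"
proof -
  have "zero_on V k T = (\<Pi>\<^sub>E v\<in>V. if v \<in> T then {0} else {..<k})"
    using assms unfolding zero_on_def PiE_def Pi_def by (auto split: if_splits)
  then have "card (zero_on V k T) = (\<Prod>v\<in>V. if v \<in> T then 1 else k)"
    using assms(1) by (simp add: card_PiE if_distrib cong: if_cong)
  also have "\<dots> = k ^ card (V \<inter> - T)"
    using assms(1) by (simp add: prod.If_cases)
  also have "V \<inter> - T = V - T" by blast
  finally show ?thesis
    using assms by (simp add: card_Diff_subset finite_subset)
qed

lemma sum_card_zero_on:
  assumes "finite V" "0 < k" "finite I" "\<And>i. i \<in> I \<Longrightarrow> T i \<subseteq> V \<and> card (T i) = j"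
  shows "(\<Sum>c\<in>V \<rightarrow>\<^sub>E {..<k}. card {i \<in> I. \<forall>v\<in>T i. c v = 0}) = card I * k ^ (card V - j)"
proof -
  have fin: "finite (V \<rightarrow>\<^sub>E {..<k})" using assms(1) by (simp add: finite_PiE)
  have "(\<Sum>c\<in>V \<rightarrow>\<^sub>E {..<k}. card {i \<in> I. \<forall>v\<in>T i. c v = 0})
      = (\<Sum>c\<in>V \<rightarrow>\<^sub>E {..<k}. \<Sum>i\<in>I. if \<forall>v\<in>T i. c v = 0 then 1 else 0)"
    using assms(3) by (simp add: sum.If_cases Int_def)
  also have "\<dots> = (\<Sum>i\<in>I. \<Sum>c\<in>V \<rightarrow>\<^sub>E {..<k}. if \<forall>v\<in>T i. c v = 0 then 1 else 0)"
    by (rule sum.swap)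
  also have "\<dots> = (\<Sum>i\<in>I. card (zero_on V k (T i)))"
    using fin by (simp add: sum.If_cases Int_def zero_on_def)
  also have "\<dots> = (\<Sum>i\<in>I. k ^ (card V - j))"
    using assms by (intro sum.cong) (auto simp: card_zero_on)
  finally show ?thesis by simp
qed

context plane_graph
begin

text \<open>These are ordered pairs, so every crossing counts twice; only constants are
  affected.\<close>

definition crossings where "crossings = {(e, f). e \<in> E \<and> f \<in> E \<and> crossing e f}"

lemma finite_crossings: "finite crossings"
  by (rule finite_subset[of _ "E \<times> E"]) (auto simp: crossings_def finite_E)

text \<open>Deleting every edge that takes part in a crossing leaves a crossing-free graph, to which
  the linear bound applies.\<close>

lemma card_edges_le_crossings: "card E \<le> 3 * card V + card crossings"
proof -
  let ?F = "E - fst ` crossings"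
  interpret F: plane_embedded_graph V ?F
  proof
    show "\<not> crossing e f" if "e \<in> ?F" "f \<in> ?F" for e f
    proof
      assume "crossing e f"
      then have "(e, f) \<in> crossings" using that by (simp add: crossings_def)
      then have "e \<in> fst ` crossings" by (metis fst_conv image_eqI)
      then show False using that by blast
    qed
  qed (use finite_V fst_V snd_V left_right vertex_free in blast)+
  have "card E \<le> card ?F + card (fst ` crossings)"
    using diff_card_le_card_Diff[of "fst ` crossings" E] finite_crossings by simp
  then show ?thesis
    using F.card_edges_le card_image_le[OF finite_crossings, of fst] by linarith
qed

text \<open>Average \<open>card_edges_le_crossings\<close> over the first colour class of all colourings of the
  vertices with \<^term>\<open>k\<close> colours.\<close>

lemma sampled_edges_le:
  assumes "0 < k"
  shows "card E * k ^ 2 \<le> 3 * card V * k ^ 3 + card crossings"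
proof (cases "card V < 4")
  case True
  \<comment> \<open>Few vertices are treated separately because \<open>card V - 4\<close>, used
    below, is a truncated difference.\<close>
  have "crossings = {}"
  proof (rule ccontr)
    assume "crossings \<noteq> {}"
    then obtain e f where ef: "e \<in> E" "f \<in> E" "crossing e f" by (auto simp: crossings_def)
    then have "{fst e, snd e, fst f, snd f} \<subseteq> V" using fst_V snd_V by blast
    then have "card {fst e, snd e, fst f, snd f} \<le> card V" by (rule card_mono[OF finite_V])
    then show False using crossing_disjoint[OF ef] True by linarith
  qed
  then have "card E \<le> 3 * card V" using card_edges_le_crossings by simp
  then have "card E * k ^ 2 \<le> 3 * card V * k ^ 2" by simp
  also have "\<dots> \<le> 3 * card V * k ^ 3" using assms by (simp add: power_increasing)
  finally show ?thesis by simp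
next
  case False
  let ?C = "V \<rightarrow>\<^sub>E {..<k}"
  \<comment> \<open>The quantifier over a singleton gives all three sets the shape of
    \<open>sum_card_zero_on\<close>, with \<open>j\<close> equal to 1, 2 and 4.\<close>
  let ?V = "\<lambda>c. {v \<in> V. \<forall>u\<in>{v}. c u = (0::nat)}"
  let ?E = "\<lambda>c. {e \<in> E. \<forall>u\<in>{fst e, snd e}. c u = (0::nat)}"
  let ?X = "\<lambda>c. {p \<in> crossings. \<forall>u\<in>{fst (fst p), snd (fst p), fst (snd p), snd (snd p)}. c u = (0::nat)}"
  have le: "card (?E c) \<le> 3 * card (?V c) + card (?X c)" for c
  proof -
    interpret S: plane_graph "?V c" "?E c"
      by unfold_locales (use finite_V fst_V snd_V left_right vertex_free in \<open>simp_all del: split_paired_All split_paired_Ex\<close>)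
    have "S.crossings = ?X c" unfolding S.crossings_def crossings_def by auto
    then show ?thesis using S.card_edges_le_crossings by simp
  qed
  have sV: "(\<Sum>c\<in>?C. card (?V c)) = card V * k ^ (card V - 1)"
    by (rule sum_card_zero_on) (use finite_V assms in auto)
  have sE: "(\<Sum>c\<in>?C. card (?E c)) = card E * k ^ (card V - 2)"
  proof (rule sum_card_zero_on)
    fix e assume e: "e \<in> E"
    then have "fst e \<noteq> snd e" using left_right by fastforce
    then show "{fst e, snd e} \<subseteq> V \<and> card {fst e, snd e} = 2" using fst_V[OF e] snd_V[OF e] by simp
  qed (use finite_V finite_E assms in auto)
  have sX: "(\<Sum>c\<in>?C. card (?X c)) = card crossings * k ^ (card V - 4)"
  proof (rule sum_card_zero_on)
    fix p assume "p \<in> crossings"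
    then have p: "fst p \<in> E" "snd p \<in> E" "crossing (fst p) (snd p)" by (auto simp: crossings_def)
    then show "{fst (fst p), snd (fst p), fst (snd p), snd (snd p)} \<subseteq> V \<and>
      card {fst (fst p), snd (fst p), fst (snd p), snd (snd p)} = 4"
      using fst_V[OF p(1)] snd_V[OF p(1)] fst_V[OF p(2)] snd_V[OF p(2)]
      by (intro conjI crossing_disjoint[OF p]) simp
  qed (use finite_V finite_crossings assms in auto)
  obtain r where r: "card V = r + 4" using False le_Suc_ex[of 4 "card V"] by (auto simp: add.commute)
  have "(\<Sum>c\<in>?C. card (?E c)) \<le> (\<Sum>c\<in>?C. 3 * card (?V c) + card (?X c))"
    by (intro sum_mono le)
  then have "card E * k ^ (card V - 2) \<le> 3 * (card V * k ^ (card V - 1)) + card crossings * k ^ (card V - 4)"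
    unfolding sV[symmetric] sE[symmetric] sX[symmetric] by (simp add: sum.distrib sum_distrib_left)
  also have "card V - 2 = r + 2" using r by simp
  also have "card V - 1 = r + 3" using r by simp
  also have "card V - 4 = r" using r by simp
  finally have "(card E * k ^ 2) * k ^ r \<le> (3 * card V * k ^ 3 + card crossings) * k ^ r"
    by (simp add: power_add power2_eq_square power3_eq_cube algebra_simps)
  then show ?thesis using assms by simp
qed

theorem crossing_lemma:
  assumes "6 * card V \<le> card E"
  shows "card E ^ 3 \<le> 288 * card V ^ 2 * card crossings"
proof (cases "card V = 0")
  case True
  then show ?thesis using E_subset finite_V by (auto simp: card_eq_0_iff)
next
  case False
  \<comment> \<open>This is the largest \<open>k\<close> for which the vertex term of
    \<open>sampled_edges_le\<close> is at most half of the edge term.\<close>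
  define k where "k = card E div (6 * card V)"
  have k: "0 < k" using assms False by (simp add: k_def div_greater_zero_iff)
  have k1: "6 * card V * k \<le> card E" by (simp add: k_def)
  have "card E < 6 * card V * (k + 1)"
    using False dividend_less_times_div[of "6 * card V" "card E"] by (simp add: k_def)
  also have "\<dots> \<le> 12 * card V * k" using k by simp
  finally have k2: "card E ^ 2 \<le> (12 * card V * k) ^ 2" by (intro power_mono) auto
  have "6 * card V * k * k ^ 2 \<le> card E * k ^ 2" using k1 by simp
  moreover have "6 * card V * k * k ^ 2 = 2 * (3 * card V * k ^ 3)"
    by (simp add: power2_eq_square power3_eq_cube)
  ultimately have X: "card E * k ^ 2 \<le> 2 * card crossings" using sampled_edges_le[OF k] by linarith
  have "card E ^ 3 = card E * card E ^ 2" by (simp add: power3_eq_cube power2_eq_square)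
  also have "\<dots> \<le> card E * (12 * card V * k) ^ 2" using k2 by simp
  also have "\<dots> = 144 * card V ^ 2 * (card E * k ^ 2)" by (simp add: power_mult_distrib)
  also have "\<dots> \<le> 144 * card V ^ 2 * (2 * card crossings)" using X by (intro mult_left_mono) auto
  finally show ?thesis by simp
qed

end

section \<open>Point sets with few projections in many directions\<close>

definition proj :: "real \<Rightarrow> real \<times> real \<Rightarrow> real" where
  "proj z p = snd p + z * fst p"

text \<open>The fibres of \<^term>\<open>proj z\<close> are the lines of slope \<^term>\<open>-z\<close>, so none is vertical.\<close>

definition next_on_line :: "(real \<times> real) set \<Rightarrow> real \<Rightarrow> (real \<times> real) \<times> (real \<times> real) \<Rightarrow> bool" where
  "next_on_line P z e \<longleftrightarrow> fst e \<in> P \<and> snd e \<in> P \<and> fst (fst e) < fst (snd e)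
     \<and> proj z (fst e) = proj z (snd e)
     \<and> (\<forall>r\<in>P. proj z r = proj z (fst e) \<longrightarrow> \<not> alive e (fst r))"

lemma next_on_line_slope:
  assumes "next_on_line P z e"
  shows "slope e = - z"
  using assms by (auto simp: next_on_line_def slope_def proj_def field_simps)

lemma next_on_line_ht:
  assumes "next_on_line P z e"
  shows "ht e x = proj z (fst e) - z * x"
  using next_on_line_slope[OF assms] by (simp add: ht_def proj_def algebra_simps)

lemma ex_next_on_line:
  assumes "finite P" "p \<in> P" "q \<in> P" "fst p < fst q" "proj z p = proj z q"
  shows "\<exists>r. next_on_line P z (p, r)"
proof -
  let ?R = "{r \<in> P. fst p < fst r \<and> proj z p = proj z r}"
  have "q \<in> ?R" using assms by simp
  then have "finite ?R" "?R \<noteq> {}" using assms(1) by (simp, blast)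
  then obtain r where "r \<in> ?R" "\<And>s. s \<in> ?R \<Longrightarrow> fst r \<le> fst s"
    by (rule ex_argmin[where f = fst]) blast
  then have "next_on_line P z (p, r)"
    using assms(2) by (fastforce simp: next_on_line_def alive_def)
  then show ?thesis by blast
qed

lemma proj_inj: "proj z p = proj z q \<Longrightarrow> fst p = fst q \<Longrightarrow> p = q"
  by (simp add: proj_def prod_eq_iff)

lemma proj_inj2: "proj z p = proj z q \<Longrightarrow> proj w p = proj w q \<Longrightarrow> z \<noteq> w \<Longrightarrow> p = q"
proof -
  assume a: "proj z p = proj z q" "proj w p = proj w q" "z \<noteq> w"
  have "(z - w) * (fst p - fst q) = (proj z p - proj z q) - (proj w p - proj w q)"
    by (simp add: proj_def algebra_simps)
  with a have "fst p = fst q" by simp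
  with a(1) show ?thesis by (rule proj_inj)
qed

definition line_edges where
  "line_edges P Z = {e. \<exists>z\<in>Z. next_on_line P z e}"

lemma plane_graph_line_edges: "finite P \<Longrightarrow> plane_graph P (line_edges P Z)"
proof
  fix e v assume "e \<in> line_edges P Z" and v: "v \<in> P" "alive e (fst v)"
  then obtain z where z: "next_on_line P z e" by (auto simp: line_edges_def)
  show "ht e (fst v) \<noteq> snd v"
  proof
    assume "ht e (fst v) = snd v"
    then have "proj z v = proj z (fst e)" using next_on_line_ht[OF z] by (simp add: proj_def)
    then show False using z v by (auto simp: next_on_line_def)
  qed
qed (auto simp: line_edges_def next_on_line_def)

text \<open>Only the rightmost point of each line starts no edge, so a direction loses at most
  \<open>K\<close> points. Edges of different directions differ in slope.\<close>

lemma card_line_edges_ge: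
  assumes P: "finite P" and Z: "finite Z" "\<And>z. z \<in> Z \<Longrightarrow> card (proj z ` P) \<le> K"
  shows "card Z * (card P - K) \<le> card (line_edges P Z)"
proof -
  let ?S = "\<lambda>z. {p \<in> P. \<exists>q. next_on_line P z (p, q)}"
  have S: "card P - K \<le> card (?S z)" if z: "z \<in> Z" for z
  proof -
    have "inj_on (proj z) (P - ?S z)"
    proof (rule inj_onI)
      fix p q assume pq: "p \<in> P - ?S z" "q \<in> P - ?S z" "proj z p = proj z q"
      then have "fst p = fst q"
        using ex_next_on_line[OF P, of p q z] ex_next_on_line[OF P, of q p z]
        by (cases "fst p" "fst q" rule: linorder_cases) auto
      then show "p = q" using pq proj_inj by blast
    qed
    then have "card (P - ?S z) \<le> card (proj z ` P)"
      by (rule card_inj_on_le) (use P in auto)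
    also have "\<dots> \<le> K" using Z(2) z .
    finally show ?thesis using P by (subst (asm) card_Diff_subset) auto
  qed
  have "\<forall>x \<in> Sigma Z ?S. \<exists>q. next_on_line P (fst x) (snd x, q)" by auto
  from bchoice[OF this] obtain n
    where n: "\<And>x. x \<in> Sigma Z ?S \<Longrightarrow> next_on_line P (fst x) (snd x, n x)" by blast
  have "inj_on (\<lambda>x. (snd x, n x)) (Sigma Z ?S)"
  proof (rule inj_onI)
    fix x y assume xy: "x \<in> Sigma Z ?S" "y \<in> Sigma Z ?S" "(snd x, n x) = (snd y, n y)"
    then have "fst x = fst y"
      using next_on_line_slope[OF n[OF xy(1)]] next_on_line_slope[OF n[OF xy(2)]] by simp
    then show "x = y" using xy(3) by (simp add: prod_eq_iff)
  qed
  moreover have "(\<lambda>x. (snd x, n x)) ` Sigma Z ?S \<subseteq> line_edges P Z"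
  proof
    fix e assume "e \<in> (\<lambda>x. (snd x, n x)) ` Sigma Z ?S"
    then obtain x where x: "x \<in> Sigma Z ?S" "e = (snd x, n x)" by blast
    then have "fst x \<in> Z" by auto
    then show "e \<in> line_edges P Z" using n[OF x(1)] x(2) by (auto simp: line_edges_def)
  qed
  ultimately have "card (Sigma Z ?S) \<le> card (line_edges P Z)"
    using plane_graph.finite_E[OF plane_graph_line_edges[OF P]] by (intro card_inj_on_le) auto
  moreover have "card Z * (card P - K) \<le> card (Sigma Z ?S)"
    using S P Z(1) sum_mono[of Z "\<lambda>_. card P - K" "\<lambda>z. card (?S z)"] by simp
  ultimately show ?thesis by linarith
qed

text \<open>Two non-parallel lines meet once, and a line together with a point interior to an edge
  on it determines the edge. So a crossing is determined by its two lines, each encoded by direction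
  and intercept.\<close>

lemma card_line_crossings_le:
  assumes P: "finite P" and Z: "finite Z" "\<And>z. z \<in> Z \<Longrightarrow> card (proj z ` P) \<le> K"
  shows "card (plane_graph.crossings (line_edges P Z)) \<le> (card Z * K) ^ 2"
proof -
  interpret plane_graph P "line_edges P Z" by (rule plane_graph_line_edges[OF P])
  let ?L = "Sigma Z (\<lambda>z. proj z ` P)"
  let ?l = "\<lambda>e. (- slope e, ht e 0)"
  let ?f = "\<lambda>x. (?l (fst x), ?l (snd x))"
  have "inj_on ?f crossings"
  proof (rule inj_onI)
    fix a b assume ab: "a \<in> crossings" "b \<in> crossings" "?f a = ?f b"
    have a: "fst a \<in> line_edges P Z" "snd a \<in> line_edges P Z" "crossing (fst a) (snd a)"
      and b: "fst b \<in> line_edges P Z" "snd b \<in> line_edges P Z" "crossing (fst b) (snd b)"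
      using ab by (auto simp: crossings_def)
    have sl: "slope (fst a) = slope (fst b)" "slope (snd a) = slope (snd b)" using ab(3) by auto
    have h: "ht e x = ht e 0 + slope e * x" for e x by (simp add: ht_def algebra_simps)
    have h1: "ht (fst a) x = ht (fst b) x" for x using ab(3) h[of "fst a" x] h[of "fst b" x] by simp
    have h2: "ht (snd a) x = ht (snd b) x" for x using ab(3) h[of "snd a" x] h[of "snd b" x] by simp
    obtain x where x: "alive (fst a) x" "alive (snd a) x" "ht (fst a) x = ht (snd a) x"
      using a(3) by (auto simp: crossing_def)
    obtain y where y: "alive (fst b) y" "alive (snd b) y" "ht (fst b) y = ht (snd b) y"
      using b(3) by (auto simp: crossing_def)
    have "(slope (fst a) - slope (snd a)) * (x - y) = 0"
      using x(3) y(3) h1[of y] h2[of y] h[of "fst a" x] h[of "snd a" x] h[of "fst a" y] h[of "snd a" y]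
      by (simp add: algebra_simps)
    then have xy: "x = y" using crossing_slope_neq[OF a] by simp
    have "fst a = fst b" by (rule same_line[OF a(1) b(1) sl(1) h1 x(1)]) (use y xy in simp)
    moreover have "snd a = snd b" by (rule same_line[OF a(2) b(2) sl(2) h2 x(2)]) (use y xy in simp)
    ultimately show "a = b" by (simp add: prod_eq_iff)
  qed
  moreover have "?l e \<in> ?L" if "e \<in> line_edges P Z" for e
  proof -
    from that obtain z where z: "z \<in> Z" "next_on_line P z e" by (auto simp: line_edges_def)
    then have "ht e 0 \<in> proj z ` P" using next_on_line_ht[OF z(2), of 0] by (auto simp: next_on_line_def)
    then show ?thesis using z(1) next_on_line_slope[OF z(2)] by simp
  qed
  then have "?f ` crossings \<subseteq> ?L \<times> ?L" unfolding crossings_def by fastforce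
  moreover have "finite (?L \<times> ?L)" using P Z(1) by simp
  ultimately have "card crossings \<le> card (?L \<times> ?L)" by (rule card_inj_on_le)
  also have "\<dots> = card ?L ^ 2" by (simp add: card_cartesian_product power2_eq_square)
  also have "\<dots> \<le> (card Z * K) ^ 2"
    using Z P sum_mono[of Z "\<lambda>z. card (proj z ` P)" "\<lambda>_. K"] by (intro power_mono) auto
  finally show ?thesis .
qed

text \<open>With many edges, the crossing lemma is combined with the two preceding counts, and 2304
  is 8 * 288. With fewer than \<open>6 * card P\<close> edges there are fewer than 12 directions,
  and two of them serve as coordinates embedding \<open>P\<close> into a \<open>K\<close> by
  \<open>K\<close> grid.\<close>

theorem few_projections:
  assumes P: "finite P" and Z: "finite Z" "\<And>z. z \<in> Z \<Longrightarrow> card (proj z ` P) \<le> K"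
    and "2 \<le> card Z" "2 * K \<le> card P"
  shows "card Z * card P \<le> 2304 * K ^ 2"
proof -
  interpret plane_graph P "line_edges P Z" by (rule plane_graph_line_edges[OF P])
  let ?E = "line_edges P Z"
  have "card P \<le> 2 * (card P - K)" using assms(5) by simp
  then have "card Z * card P \<le> 2 * (card Z * (card P - K))"
    by (metis mult.left_commute mult_le_mono2)
  then have E: "card Z * card P \<le> 2 * card ?E"
    using card_line_edges_ge[OF P Z] by linarith
  show ?thesis
  proof (cases "6 * card P \<le> card ?E")
    case True
    have "(card Z * card P) ^ 3 \<le> (2 * card ?E) ^ 3" using E by (intro power_mono) auto
    also have "\<dots> = 8 * card ?E ^ 3" by (simp add: power_mult_distrib)
    also have "\<dots> \<le> 8 * (288 * card P ^ 2 * card crossings)" by (intro mult_left_mono crossing_lemma[OF True]) simp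
    also have "\<dots> \<le> 8 * (288 * card P ^ 2 * (card Z * K) ^ 2)"
      using card_line_crossings_le[OF P Z] by simp
    finally have "(card Z * card P) * (card Z * card P) ^ 2 \<le> (2304 * K ^ 2) * (card Z * card P) ^ 2"
      by (simp add: power_mult_distrib power3_eq_cube power2_eq_square algebra_simps)
    then show ?thesis by (cases "card Z * card P = 0") auto
  next
    case False
    then have "card Z * card P < 12 * card P" using E by linarith
    then have M: "card Z < 12" by simp
    obtain z w where zw: "z \<in> Z" "w \<in> Z" "z \<noteq> w"
      using assms(4) card_le_Suc0_iff_eq[OF Z(1)] by auto
    have "inj_on (\<lambda>p. (proj z p, proj w p)) P"
      by (rule inj_onI) (use zw(3) proj_inj2[of z _ _ w] in simp)
    then have "card P \<le> card (proj z ` P \<times> proj w ` P)"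
      by (rule card_inj_on_le) (use P in auto)
    also have "\<dots> \<le> K * K" unfolding card_cartesian_product by (intro mult_mono Z zw) auto
    finally have "card Z * card P \<le> 12 * (K * K)" using M by (intro mult_mono) auto
    then show ?thesis by (simp add: power2_eq_square)
  qed
qed

section \<open>Squeezing products into gaps\<close>

lemma card_ge_disjoint_parts:
  fixes c :: real and n :: nat
  assumes "finite Y" "disjoint_family_on S {..<n}"
    and S: "\<And>i. i < n \<Longrightarrow> S i \<subseteq> Y" "\<And>i. i < n \<Longrightarrow> c \<le> card (S i)"
  shows "n * c \<le> card Y"
proof -
  have fin: "finite (S i)" if "i < n" for i using S(1)[OF that] assms(1) finite_subset by blast
  have "n * c = (\<Sum>i<n. c)" by simp
  also have "\<dots> \<le> (\<Sum>i<n. real (card (S i)))" using S(2) by (intro sum_mono) simp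
  also have "\<dots> = real (card (\<Union>i<n. S i))"
    using fin assms(2) by (subst card_UN_disjoint) (auto simp: disjoint_family_on_def)
  also have "\<dots> \<le> card Y" using S(1) assms(1) by (intro of_nat_mono card_mono) auto
  finally show ?thesis .
qed

text \<open>\<open>U\<close> collects \<open>k\<close> largest values greedily, leaving the lower
  part \<open>J - U\<close>. Because of ties, a threshold on \<open>f\<close> would not give a set
  of prescribed size.\<close>

lemma ex_lower_part:
  fixes f :: "'a \<Rightarrow> real"
  assumes "finite J" "k \<le> card J"
  shows "\<exists>U\<subseteq>J. card U = k \<and> (\<forall>l\<in>J - U. \<forall>u\<in>U. f l \<le> f u)"
  using assms(2)
proof (induction k)
  case 0
  show ?case by (intro exI[of _ "{}"]) simp
next
  case (Suc k)
  then obtain U where U: "U \<subseteq> J" "card U = k" "\<forall>l\<in>J - U. \<forall>u\<in>U. f l \<le> f u" by auto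
  have "finite U" using U(1) assms(1) finite_subset by blast
  have "J - U \<noteq> {}" using U Suc.prems by force
  have "Max (f ` (J - U)) \<in> f ` (J - U)" using \<open>J - U \<noteq> {}\<close> assms(1) by simp
  then obtain x where x: "x \<in> J - U" "f x = Max (f ` (J - U))" by auto
  have "f l \<le> f x" if "l \<in> J - U" for l using that x(2) assms(1) by simp
  then show ?case
    using U x(1) \<open>finite U\<close> by (intro exI[of _ "insert x U"]) auto
qed

text \<open>The element \<^term>\<open>a u * r\<close> lies in the gap above \<^term>\<open>a u\<close> whenever the gap ratio
  \<^term>\<open>r\<close> is no larger than that of the gap itself, so all these products are distinct.\<close>

lemma squeeze_into_gaps:
  fixes a :: "nat \<Rightarrow> real"
  assumes pos: "\<And>i. i \<le> n \<Longrightarrow> 0 < a i" and mono: "\<And>i j. i < j \<Longrightarrow> j \<le> n \<Longrightarrow> a i < a j"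
    and LU: "L \<subseteq> {..<n}" "U \<subseteq> {..<n}"
      "\<And>l u. l \<in> L \<Longrightarrow> u \<in> U \<Longrightarrow> a (Suc l) / a l \<le> a (Suc u) / a u"
  shows "card U * card ((\<lambda>l. a (Suc l) / a l) ` L)
    \<le> card ((\<lambda>(i, j, k). a i * a j / a k) ` ({..n} \<times> {..n} \<times> {..n}) \<inter> {a 0<..a n})"
proof -
  let ?r = "\<lambda>l. a (Suc l) / a l"
  let ?T = "(\<lambda>(i, j, k). a i * a j / a k) ` ({..n} \<times> {..n} \<times> {..n}) \<inter> {a 0<..a n}"
  have ge: "a i \<le> a j" if "i \<le> j" "j \<le> n" for i j
    using mono[of i j] that by (cases "i = j") auto
  have gap: "a u < a u * r" "a u * r \<le> a (Suc u)" if "u \<in> U" "r \<in> ?r ` L" for u r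
  proof -
    from that(2) obtain l where l: "l \<in> L" "r = ?r l" by auto
    have "0 < a l" "a l < a (Suc l)" "0 < a u" using pos mono l(1) that(1) LU by auto
    moreover from this have "1 < r" using l(2) by simp
    moreover have "r \<le> a (Suc u) / a u" using LU(3)[OF l(1) that(1)] l(2) by simp
    ultimately show "a u < a u * r" "a u * r \<le> a (Suc u)"
      by (simp_all add: pos_le_divide_eq mult.commute)
  qed
  have sep: "a u * r \<noteq> a v * s" if "u < v" "u \<in> U" "v \<in> U" "r \<in> ?r ` L" "s \<in> ?r ` L" for u v r s
  proof -
    have "v < n" using that(3) LU(2) by blast
    then have "a (Suc u) \<le> a v" using that(1) ge[of "Suc u" v] by simp
    then show ?thesis using gap(2)[OF that(2,4)] gap(1)[OF that(3,5)] by linarith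
  qed
  have "inj_on (\<lambda>(u, r). a u * r) (U \<times> ?r ` L)"
  proof (rule inj_onI, clarify)
    fix u l v k assume *: "u \<in> U" "l \<in> L" "v \<in> U" "k \<in> L" "a u * ?r l = a v * ?r k"
    have "\<not> u < v"
      using sep[OF _ *(1,3) imageI[OF *(2)] imageI[OF *(4)]] *(5) by linarith
    moreover have "\<not> v < u"
      using sep[OF _ *(3,1) imageI[OF *(4)] imageI[OF *(2)]] *(5) by linarith
    ultimately have "u = v" by simp
    moreover have "0 < a u" using pos[of u] *(1) LU(2) by force
    ultimately show "u = v \<and> ?r l = ?r k" using *(5) mult_left_cancel[of "a u" "?r l" "?r k"] by auto
  qed
  moreover have "(\<lambda>(u, r). a u * r) ` (U \<times> ?r ` L) \<subseteq> ?T"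
  proof clarify
    fix u l assume ul: "u \<in> U" "l \<in> L"
    have "a u * ?r l = (\<lambda>(i, j, k). a i * a j / a k) (u, Suc l, l)" by simp
    moreover have "(u, Suc l, l) \<in> {..n} \<times> {..n} \<times> {..n}" using ul LU by auto
    ultimately have "a u * ?r l \<in> (\<lambda>(i, j, k). a i * a j / a k) ` ({..n} \<times> {..n} \<times> {..n})"
      by (rule image_eqI)
    moreover have "u < n" using ul LU by blast
    then have "a 0 < a u * ?r l" "a u * ?r l \<le> a n"
      using gap[OF ul(1) imageI[OF ul(2)]] ge[of 0 u] ge[of "Suc u" n] by simp_all
    ultimately show "a u * ?r l \<in> ?T" by simp
  qed
  moreover have "finite ?T" by simp
  ultimately have "card (U \<times> ?r ` L) \<le> card ?T" by (rule card_inj_on_le)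
  then show ?thesis by (simp add: card_cartesian_product)
qed

section \<open>Gap ratios of Moebius functions\<close>

text \<open>This is the factor contributed by an inner vertex \<open>w\<close> to the alternating
  product of a path going from \<open>x\<close> through \<open>w\<close> to
  \<open>q\<close>.\<close>

definition moebius :: "real \<Rightarrow> real \<Rightarrow> real \<Rightarrow> real" where
  "moebius x q w = (1 + w * q) / (1 + w * x)"

lemma moebius_pos: "0 \<le> x \<Longrightarrow> 0 \<le> q \<Longrightarrow> 0 \<le> w \<Longrightarrow> 0 < moebius x q w"
  by (simp add: moebius_def add_pos_nonneg)

lemma moebius_strict_mono:
  assumes "0 \<le> x" "x < q" "0 \<le> w" "w < v"
  shows "moebius x q w < moebius x q v"
proof -
  have p: "0 < 1 + w * x" "0 < 1 + v * x" using assms by (auto intro: add_pos_nonneg)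
  have "(1 + v * q) * (1 + w * x) - (1 + w * q) * (1 + v * x) = (v - w) * (q - x)" by algebra
  moreover have "0 < (v - w) * (q - x)" using assms by simp
  ultimately show ?thesis using p by (simp add: moebius_def divide_simps)
qed

text \<open>Since \<^term>\<open>moebius x p\<close> and \<^term>\<open>moebius x q\<close> are affine functions of each other with
  nonzero constant term, a gap is determined by its two ratios.\<close>

lemma moebius_gap_determined:
  assumes x: "0 \<le> x" "x < p" "p < q" and w: "0 \<le> w" "w < w'" and v: "0 \<le> v" "v < v'"
    and eq: "moebius x p w' / moebius x p w = moebius x p v' / moebius x p v"
      "moebius x q w' / moebius x q w = moebius x q v' / moebius x q v"
  shows "w = v"
proof -
  let ?f = "moebius x p" and ?g = "moebius x q"
  define \<alpha> where "\<alpha> = (q - x) / (p - x)"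
  have aff: "?g t = \<alpha> * ?f t + (1 - \<alpha>)" if "0 \<le> t" for t
  proof -
    have "0 < 1 + t * x" using that x by (auto intro: add_pos_nonneg)
    then show ?thesis using x unfolding moebius_def \<alpha>_def by (simp add: divide_simps) algebra
  qed
  have \<alpha>: "1 < \<alpha>" using x by (simp add: \<alpha>_def)
  have pos: "0 < ?f w" "0 < ?f v" "0 < ?g w" "0 < ?g v" using moebius_pos x w v by auto
  define r s where "r = ?f w' / ?f w" and "s = ?g w' / ?g w"
  have rw: "?f w' = r * ?f w" "?g w' = s * ?g w" using pos by (auto simp: r_def s_def)
  have rv: "?f v' = r * ?f v" "?g v' = s * ?g v" using pos eq by (auto simp: r_def s_def)
  have s: "s > 1" using moebius_strict_mono[of x q w w'] x w pos by (simp add: s_def)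
  \<comment> \<open>Inserting both ends of the gap into the affine relation leaves a linear equation
    for \<open>?f w\<close>; \<open>?f v\<close> satisfies the same one, and its right-hand side is
    nonzero.\<close>
  have 1: "\<alpha> * (r - s) * ?f w = (s - 1) * (1 - \<alpha>)"
  proof -
    have "\<alpha> * (r * ?f w) + (1 - \<alpha>) = s * (\<alpha> * ?f w + (1 - \<alpha>))"
      using rw aff[of w] aff[of w'] w by simp
    then show ?thesis by (simp add: algebra_simps)
  qed
  have 2: "\<alpha> * (r - s) * ?f v = (s - 1) * (1 - \<alpha>)"
  proof -
    have "\<alpha> * (r * ?f v) + (1 - \<alpha>) = s * (\<alpha> * ?f v + (1 - \<alpha>))"
      using rv aff[of v] aff[of v'] v by simp
    then show ?thesis by (simp add: algebra_simps)
  qed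
  have "(s - 1) * (1 - \<alpha>) \<noteq> 0" using s \<alpha> by simp
  then have "\<alpha> * (r - s) \<noteq> 0" using 1 by auto
  then have "?f w = ?f v" using 1 2 by (metis mult_left_cancel)
  then show "w = v"
    using moebius_strict_mono[of x p w v] moebius_strict_mono[of x p v w] x w v by linarith
qed

definition window_products where
  "window_products x q w n = (\<lambda>(i, j, k). moebius x q (w i) * moebius x q (w j) / moebius x q (w k))
     ` ({..n} \<times> {..n} \<times> {..n}) \<inter> {moebius x q (w 0)<..moebius x q (w n)}"

text \<open>Set aside the \<open>h\<close> gaps of largest ratio for \<open>p\<close> and for
  \<open>q\<close>. At least \<open>2 * h\<close> gaps remain, and each is determined by its pair of
  ratios, so for \<open>p\<close> or for \<open>q\<close> there are at least
  \<open>sqrt (2 * h)\<close> ratios. These are squeezed into each of the \<open>h\<close> large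
  gaps.\<close>

lemma card_window_products:
  fixes w :: "nat \<Rightarrow> real"
  assumes x: "0 \<le> x" "x < p" "p < q"
    and w: "\<And>i. i \<le> 4 * h \<Longrightarrow> 0 \<le> w i" "\<And>i j. i < j \<Longrightarrow> j \<le> 4 * h \<Longrightarrow> w i < w j"
  shows "\<exists>y\<in>{p, q}. real h * sqrt (2 * real h) \<le> card (window_products x y w (4 * h))"
proof -
  let ?n = "4 * h"
  let ?r = "\<lambda>y l. moebius x y (w (Suc l)) / moebius x y (w l)"
  have ex: "\<exists>U\<subseteq>{..<?n}. card U = h \<and> (\<forall>l\<in>{..<?n} - U. \<forall>u\<in>U. ?r y l \<le> ?r y u)" for y
    by (rule ex_lower_part) auto
  obtain U where U: "U \<subseteq> {..<?n}" "card U = h" "\<forall>l\<in>{..<?n} - U. \<forall>u\<in>U. ?r p l \<le> ?r p u"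
    using ex by blast
  obtain W where W: "W \<subseteq> {..<?n}" "card W = h" "\<forall>l\<in>{..<?n} - W. \<forall>u\<in>W. ?r q l \<le> ?r q u"
    using ex by blast
  have bound: "h * card (?r y ` L) \<le> card (window_products x y w ?n)"
    if "x < y" "S \<subseteq> {..<?n}" "card S = h" "\<forall>l\<in>{..<?n} - S. \<forall>u\<in>S. ?r y l \<le> ?r y u" "L = {..<?n} - S"
    for y S L
  proof -
    have "card S * card (?r y ` L) \<le> card (window_products x y w ?n)"
      unfolding window_products_def
    proof (rule squeeze_into_gaps)
      show "0 < moebius x y (w i)" if "i \<le> ?n" for i
        using moebius_pos[of x y "w i"] w(1)[OF that] x(1) \<open>x < y\<close> by simp
      show "moebius x y (w i) < moebius x y (w j)" if "i < j" "j \<le> ?n" for i j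
        by (rule moebius_strict_mono) (use w that x(1) \<open>x < y\<close> in auto)
    qed (use that in auto)
    then show ?thesis using that(3) by simp
  qed
  let ?J = "{..<?n} - (U \<union> W)"
  have "card (U \<union> W) \<le> 2 * h" using card_Un_le[of U W] U W by simp
  then have J: "2 * h \<le> card ?J"
    using U(1) W(1) by (subst card_Diff_subset) (auto intro: finite_subset)
  have "inj_on (\<lambda>j. (?r p j, ?r q j)) ?J"
  proof (rule inj_onI)
    fix i j assume ij: "i \<in> ?J" "j \<in> ?J" "(?r p i, ?r q i) = (?r p j, ?r q j)"
    have "i < ?n" "j < ?n" using ij by auto
    then have "0 \<le> w i" "w i < w (Suc i)" "0 \<le> w j" "w j < w (Suc j)" using w by auto
    then have "w i = w j"
      using moebius_gap_determined[OF x, of "w i" "w (Suc i)" "w j" "w (Suc j)"] ij(3) by blast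
    then show "i = j" using w(2)[of i j] w(2)[of j i] ij by (cases i j rule: linorder_cases) auto
  qed
  then have "card ?J \<le> card (?r p ` ({..<?n} - U) \<times> ?r q ` ({..<?n} - W))"
    by (rule card_inj_on_le) auto
  then have "2 * h \<le> card (?r p ` ({..<?n} - U)) * card (?r q ` ({..<?n} - W))" (is "_ \<le> ?a * ?b")
    using J by (simp add: card_cartesian_product)
  then have "real (2 * h) \<le> real (?a * ?b)" by (simp only: of_nat_le_iff)
  then have ab: "2 * real h \<le> real ?a * real ?b" by (simp only: of_nat_mult of_nat_numeral)
  have "sqrt (2 * real h) \<le> real ?a \<or> sqrt (2 * real h) \<le> real ?b"
  proof (rule ccontr)
    assume "\<not> ?thesis"
    then have "real ?a * real ?b < sqrt (2 * real h) * sqrt (2 * real h)"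
      by (intro mult_strict_mono') auto
    then show False using ab by simp
  qed
  moreover have "real h * real ?a \<le> card (window_products x p w ?n)"
    using bound[OF x(2) U refl] unfolding of_nat_mult[symmetric] of_nat_le_iff .
  moreover have "real h * real ?b \<le> card (window_products x q w ?n)"
    using bound[OF less_trans[OF x(2,3)] W refl] unfolding of_nat_mult[symmetric] of_nat_le_iff .
  ultimately show ?thesis
  proof (elim disjE)
    assume "sqrt (2 * real h) \<le> real ?a"
    then have "real h * sqrt (2 * real h) \<le> real h * real ?a" by (rule mult_left_mono) simp
    then show ?thesis using \<open>real h * real ?a \<le> _\<close> by (intro bexI[of _ p]) (linarith, simp)
  next
    assume "sqrt (2 * real h) \<le> real ?b"
    then have "real h * sqrt (2 * real h) \<le> real h * real ?b" by (rule mult_left_mono) simp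
    then show ?thesis using \<open>real h * real ?b \<le> _\<close> by (intro bexI[of _ q]) (linarith, simp)
  qed
qed

section \<open>Alternating products along paths\<close>

lemma prod_cases8:
  obtains a b c d e f g h where "y = (a, b, c, d, e, f, g, h)"
proof (cases y rule: prod_cases7)
  case (fields a b c d e f g)
  then show ?thesis using that by (cases g) auto
qed

definition path_product :: "real \<Rightarrow> real \<Rightarrow> real \<times> real \<times> real \<times> real \<times> real \<times> real \<times> real \<Rightarrow> real" where
  "path_product z z' = (\<lambda>(x1, w1, x2, w2, x3, w3, x4).
     ((1 + z * x1) * (1 + w1 * x2) * (1 + w2 * x3) * (1 + w3 * x4)) /
     ((1 + w1 * x1) * (1 + w2 * x2) * (1 + w3 * x3) * (1 + z' * x4)))"

text \<open>Each inner scalar \<open>a1\<close> to \<open>a7\<close> occurs once above and once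
  below; only the end scalars survive.\<close>

lemma telescope8:
  fixes e1 :: real
  assumes "a0 \<noteq> 0" "a1 \<noteq> 0" "a2 \<noteq> 0" "a3 \<noteq> 0" "a4 \<noteq> 0" "a5 \<noteq> 0" "a6 \<noteq> 0" "a7 \<noteq> 0"
  shows "((a0 * a1 * e1) * (a2 * a3 * e3) * (a4 * a5 * e5) * (a6 * a7 * e7)) /
      ((a2 * a1 * e2) * (a4 * a3 * e4) * (a6 * a5 * e6) * (a8 * a7 * e8))
    = a0 / a8 * ((e1 * e3 * e5 * e7) / (e2 * e4 * e6 * e8))"
  using assms by (simp add: divide_simps)

text \<open>A value \<^term>\<open>y\<close> of \<^const>\<open>path_product\<close> can be lifted to an eight-tuple of elements of
  \<^term>\<open>D\<close> for every choice of one scalar at each of the seven inner vertices; the end scalars being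
  fixed, the alternating product of the tuple recovers \<^term>\<open>y\<close> and then, one after another, the
  scalars.\<close>

lemma card_path_products_le:
  fixes X Z D :: "real set" and \<alpha> :: "real \<Rightarrow> nat \<Rightarrow> real"
  assumes fin: "finite X" "finite Z" "finite D"
    and nonneg: "\<And>x. x \<in> X \<union> Z \<Longrightarrow> 0 \<le> x"
    and pos: "\<And>x i. x \<in> X \<union> Z \<Longrightarrow> i < m \<Longrightarrow> 0 < \<alpha> x i"
    and inj: "\<And>x. x \<in> X \<union> Z \<Longrightarrow> inj_on (\<alpha> x) {..<m}"
    and D: "\<And>x z i j. x \<in> X \<Longrightarrow> z \<in> Z \<Longrightarrow> i < m \<Longrightarrow> j < m \<Longrightarrow> \<alpha> z i * \<alpha> x j * (1 + z * x) \<in> D"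
    and z: "z \<in> Z" "z' \<in> Z" and m: "0 < m"
  shows "card (path_product z z' ` (X \<times> Z \<times> X \<times> Z \<times> X \<times> Z \<times> X)) * m ^ 7 \<le> card D ^ 8"
proof -
  let ?T = "X \<times> Z \<times> X \<times> Z \<times> X \<times> Z \<times> X"
  let ?Y = "path_product z z' ` ?T"
  let ?I = "{..<m}"
  define t where "t = inv_into ?T (path_product z z')"
  have t: "t y \<in> ?T" "path_product z z' (t y) = y" if "y \<in> ?Y" for y
    using that inv_into_into[of y "path_product z z'" ?T] f_inv_into_f[of y "path_product z z'" ?T]
    unfolding t_def by blast+
  define d where "d = (\<lambda>v i w j. \<alpha> v i * \<alpha> w j * (1 + v * w))"
  \<comment> \<open>One path \<open>t y\<close> is fixed for each value. The end vertices always
    take scalar number 0, which exists since \<open>0 < m\<close>, so \<open>R\<close> can divide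
    out a known constant.\<close>
  define F where "F = (\<lambda>(y, i1, i2, i3, i4, i5, i6, i7). case t y of (x1, w1, x2, w2, x3, w3, x4) \<Rightarrow>
    (d z 0 x1 i1, d w1 i2 x1 i1, d w1 i2 x2 i3, d w2 i4 x2 i3, d w2 i4 x3 i5, d w3 i6 x3 i5, d w3 i6 x4 i7, d z' 0 x4 i7))"
  let ?Dom = "?Y \<times> ?I \<times> ?I \<times> ?I \<times> ?I \<times> ?I \<times> ?I \<times> ?I"
  let ?Cod = "D \<times> D \<times> D \<times> D \<times> D \<times> D \<times> D \<times> D"
  have e: "1 + w * x \<noteq> 0" if "x \<in> X" "w \<in> Z" for x w
    using nonneg[of x] nonneg[of w] that by (metis UnCI add_nonneg_eq_0_iff mult_nonneg_nonneg zero_le_one zero_neq_one)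
  have a: "\<alpha> x i \<noteq> 0" if "x \<in> X \<union> Z" "i < m" for x i
    using pos[OF that] by simp
  have dx: "i = i'" if "d w j x i = d w j x i'" "x \<in> X" "w \<in> Z" "i < m" "i' < m" "j < m" for w j x i i'
  proof -
    have "\<alpha> x i = \<alpha> x i'" using that(1) e[OF that(2,3)] a[of w j] that(3,6) by (simp add: d_def)
    then show ?thesis using inj[of x] that by (auto dest: inj_onD)
  qed
  have dw: "j = j'" if "d w j x i = d w j' x i" "x \<in> X" "w \<in> Z" "i < m" "j' < m" "j < m" for w j x i j'
  proof -
    have "\<alpha> w j = \<alpha> w j'" using that(1) e[OF that(2,3)] a[of x i] that(2,4) by (simp add: d_def)
    then show ?thesis using inj[of w] that by (auto dest: inj_onD)
  qed
  define R where "R = (\<lambda>(d1, d2, d3, d4, d5, d6, d7, d8). \<alpha> z' 0 / \<alpha> z 0 * ((d1 * d3 * d5 * d7) / (d2 * d4 * d6 * d8 :: real)))"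
  have R: "R (F p) = fst p" if p_in: "p \<in> ?Dom" for p
  proof -
    obtain y i1 i2 i3 i4 i5 i6 i7 where p: "p = (y, i1, i2, i3, i4, i5, i6, i7)" by (rule prod_cases8)
    have y: "y \<in> ?Y" and i: "i1 < m" "i2 < m" "i3 < m" "i4 < m" "i5 < m" "i6 < m" "i7 < m"
      using p_in p by auto
    obtain x1 w1 x2 w2 x3 w3 x4 where ty: "t y = (x1, w1, x2, w2, x3, w3, x4)" by (rule prod_cases7)
    have v: "x1 \<in> X" "w1 \<in> Z" "x2 \<in> X" "w2 \<in> Z" "x3 \<in> X" "w3 \<in> Z" "x4 \<in> X"
      using t(1)[OF y] ty by auto
    have "R (F p) = \<alpha> z' 0 / \<alpha> z 0 * (\<alpha> z 0 / \<alpha> z' 0 * path_product z z' (t y))"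
      unfolding R_def F_def p ty d_def path_product_def prod.case
      by (subst telescope8) (use a v z i m in auto)
    also have "\<dots> = y" using t(2)[OF y] a[of z 0] a[of z' 0] z m by simp
    finally show ?thesis by (simp add: p)
  qed
  have "inj_on F ?Dom"
  proof (rule inj_onI)
    fix p q assume pq: "p \<in> ?Dom" "q \<in> ?Dom" "F p = F q"
    obtain y i1 i2 i3 i4 i5 i6 i7 where p: "p = (y, i1, i2, i3, i4, i5, i6, i7)" by (rule prod_cases8)
    obtain y' j1 j2 j3 j4 j5 j6 j7 where q: "q = (y', j1, j2, j3, j4, j5, j6, j7)" by (rule prod_cases8)
    have y': "y' = y" using R[OF pq(1)] R[OF pq(2)] pq(3) p q by simp
    have y: "y \<in> ?Y" and i: "i1 < m" "i2 < m" "i3 < m" "i4 < m" "i5 < m" "i6 < m" "i7 < m"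
      "j1 < m" "j2 < m" "j3 < m" "j4 < m" "j5 < m" "j6 < m" "j7 < m"
      using pq p q by auto
    obtain x1 w1 x2 w2 x3 w3 x4 where ty: "t y = (x1, w1, x2, w2, x3, w3, x4)" by (rule prod_cases7)
    have v: "x1 \<in> X" "w1 \<in> Z" "x2 \<in> X" "w2 \<in> Z" "x3 \<in> X" "w3 \<in> Z" "x4 \<in> X"
      using t(1)[OF y] ty by auto
    have eq: "d z 0 x1 i1 = d z 0 x1 j1" "d w1 i2 x1 i1 = d w1 j2 x1 j1" "d w1 i2 x2 i3 = d w1 j2 x2 j3"
      "d w2 i4 x2 i3 = d w2 j4 x2 j3" "d w2 i4 x3 i5 = d w2 j4 x3 j5" "d w3 i6 x3 i5 = d w3 j6 x3 j5"
      "d w3 i6 x4 i7 = d w3 j6 x4 j7"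
      using pq(3) unfolding F_def p q y' ty prod.case prod.inject by blast+
    have 1: "i1 = j1" using dx[OF eq(1)] v z i m by simp
    have 2: "i2 = j2" using dw[OF eq(2)[folded 1]] v i by simp
    have 3: "i3 = j3" using dx[OF eq(3)[folded 2]] v i by simp
    have 4: "i4 = j4" using dw[OF eq(4)[folded 3]] v i by simp
    have 5: "i5 = j5" using dx[OF eq(5)[folded 4]] v i by simp
    have 6: "i6 = j6" using dw[OF eq(6)[folded 5]] v i by simp
    have 7: "i7 = j7" using dx[OF eq(7)[folded 6]] v i by simp
    show "p = q" using p q y' 1 2 3 4 5 6 7 by simp
  qed
  moreover have "F ` ?Dom \<subseteq> ?Cod"
  proof
    fix c assume "c \<in> F ` ?Dom"
    then obtain y i1 i2 i3 i4 i5 i6 i7 where c: "c = F (y, i1, i2, i3, i4, i5, i6, i7)"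
      and y: "y \<in> ?Y" and i: "i1 < m" "i2 < m" "i3 < m" "i4 < m" "i5 < m" "i6 < m" "i7 < m"
      by auto
    obtain x1 w1 x2 w2 x3 w3 x4 where ty: "t y = (x1, w1, x2, w2, x3, w3, x4)" by (rule prod_cases7)
    have v: "x1 \<in> X" "w1 \<in> Z" "x2 \<in> X" "w2 \<in> Z" "x3 \<in> X" "w3 \<in> Z" "x4 \<in> X"
      using t(1)[OF y] ty by auto
    show "c \<in> ?Cod"
      unfolding c F_def ty prod.case d_def using D v z i m by simp
  qed
  moreover have "finite ?Cod" using fin by simp
  ultimately have "card ?Dom \<le> card ?Cod" by (rule card_inj_on_le)
  then show ?thesis by (simp add: card_cartesian_product power_numeral_reduce mult.assoc)
qed

text \<open>The decreasing function \<open>F\<close> cuts a line at every second \<open>x i\<close>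
  into \<open>2 * h\<close> disjoint half-open gaps. The skipped point and the right end of each gap
  are the two candidates for \<open>q\<close> in \<open>card_window_products\<close>.\<close>

lemma card_path_products_ge:
  fixes x w :: "nat \<Rightarrow> real"
  assumes x: "\<And>i. i \<le> 4 * h \<Longrightarrow> 0 \<le> x i" "\<And>i j. i < j \<Longrightarrow> j \<le> 4 * h \<Longrightarrow> x i < x j"
    and w: "\<And>i. i \<le> 4 * h \<Longrightarrow> 0 \<le> w i" "\<And>i j. i < j \<Longrightarrow> j \<le> 4 * h \<Longrightarrow> w i < w j"
    and X: "X = x ` {..4 * h}" and Z: "Z = w ` {..4 * h}" and h: "0 < h"
  shows "2 * real h * (real h * sqrt (2 * real h))
    \<le> card (path_product (w 0) (w (4 * h)) ` (X \<times> Z \<times> X \<times> Z \<times> X \<times> Z \<times> X))"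
proof -
  let ?n = "4 * h" and ?z = "w 0" and ?z' = "w (4 * h)"
  let ?Y = "path_product ?z ?z' ` (X \<times> Z \<times> X \<times> Z \<times> X \<times> Z \<times> X)"
  define F where "F = (\<lambda>u. (1 + ?z * u) / (1 + ?z' * u))"
  have z: "0 \<le> ?z" "?z < ?z'" using w h by auto
  have pos: "0 < 1 + u * v" if "0 \<le> u" "0 \<le> v" for u v :: real
    using that by (simp add: add_pos_nonneg)
  have F: "F v < F u" if "0 \<le> u" "u < v" for u v
  proof -
    have p: "0 < 1 + ?z' * u" "0 < 1 + ?z' * v" using that z by (auto intro!: pos)
    have "(1 + ?z * u) * (1 + ?z' * v) - (1 + ?z * v) * (1 + ?z' * u) = (?z' - ?z) * (v - u)" by algebra
    moreover have "0 < (?z' - ?z) * (v - u)" using that z by simp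
    ultimately show ?thesis using p by (simp add: F_def divide_simps)
  qed
  have ex: "\<exists>S. S \<subseteq> ?Y \<and> S \<subseteq> {F (x (2 * k + 2))<..F (x (2 * k))} \<and> real h * sqrt (2 * real h) \<le> card S"
    if k: "k < 2 * h" for k
  proof -
    let ?a = "x (2 * k)" and ?b = "x (2 * k + 2)"
    have ab: "0 \<le> ?a" "?a < x (2 * k + 1)" "x (2 * k + 1) < ?b"
      using k x(1)[of "2 * k"] x(2)[of "2 * k" "2 * k + 1"] x(2)[of "2 * k + 1" "2 * k + 2"] by simp_all
    obtain y where y: "y \<in> {x (2 * k + 1), ?b}"
      and card: "real h * sqrt (2 * real h) \<le> card (window_products ?a y w ?n)"
      by (rule bexE[OF card_window_products[OF ab w]])
    have ay: "?a < y" "y \<le> ?b" "y \<in> X" "?a \<in> X"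
      using y ab k unfolding X by auto
    \<comment> \<open>This factor carries the window from \<open>moebius ?a y ?z\<close> to
      \<open>moebius ?a y ?z'\<close> onto the gap from \<open>F y\<close> to
      \<open>F ?a\<close>.\<close>
    define c where "c = (1 + ?z * ?a) / (1 + ?z' * y)"
    have "0 \<le> ?z'" "0 \<le> y" using z ab ay by auto
    note p = pos[OF z(1) ab(1)] pos[OF z(1) \<open>0 \<le> y\<close>] pos[OF \<open>0 \<le> ?z'\<close> ab(1)] pos[OF \<open>0 \<le> ?z'\<close> \<open>0 \<le> y\<close>]
    have c: "0 < c" using p by (simp add: c_def)
    have cz: "c * moebius ?a y ?z = F y" "c * moebius ?a y ?z' = F ?a"
      using p by (simp_all add: c_def moebius_def F_def)
    let ?S = "(*) c ` window_products ?a y w ?n"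
    have "?S \<subseteq> {F ?b<..F ?a}"
    proof clarify
      fix t assume "t \<in> window_products ?a y w ?n"
      then have "moebius ?a y ?z < t" "t \<le> moebius ?a y ?z'" by (auto simp: window_products_def)
      then have "c * moebius ?a y ?z < c * t" "c * t \<le> c * moebius ?a y ?z'" using c by auto
      moreover have "F ?b \<le> F y" using F[of y ?b] ay ab by (cases "y = ?b") auto
      ultimately show "c * t \<in> {F ?b<..F ?a}" using cz by simp
    qed
    moreover have "?S \<subseteq> ?Y"
    proof clarify
      fix t assume "t \<in> window_products ?a y w ?n"
      then obtain i j l where ijl: "i \<le> ?n" "j \<le> ?n" "l \<le> ?n"
        and t: "t = moebius ?a y (w i) * moebius ?a y (w j) / moebius ?a y (w l)"
        by (auto simp: window_products_def)
      have ne: "1 + w u * y \<noteq> 0" "1 + w u * ?a \<noteq> 0" if "u \<le> ?n" for u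
        using pos[OF w(1)[OF that] \<open>0 \<le> y\<close>] pos[OF w(1)[OF that] ab(1)] by auto
      \<comment> \<open>The path alternates between \<open>?a\<close> and \<open>y\<close>; passing
        \<open>w l\<close> in the opposite direction, from \<open>y\<close> to \<open>?a\<close>,
        produces the reciprocal factor.\<close>
      have "c * t = path_product ?z ?z' (?a, w i, y, w l, ?a, w j, y)"
        using ne[OF ijl(1)] ne[OF ijl(2)] ne[OF ijl(3)] p
        by (simp add: t c_def moebius_def path_product_def divide_simps)
      moreover have "(?a, w i, y, w l, ?a, w j, y) \<in> X \<times> Z \<times> X \<times> Z \<times> X \<times> Z \<times> X"
        using ay ijl Z by auto
      ultimately show "c * t \<in> ?Y" by (rule image_eqI)
    qed
    moreover have "card ?S = card (window_products ?a y w ?n)"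
      by (rule card_image) (use c in \<open>auto intro!: inj_onI\<close>)
    ultimately show ?thesis using card by metis
  qed
  then obtain S where S: "\<And>k. k < 2 * h \<Longrightarrow> S k \<subseteq> ?Y"
    "\<And>k. k < 2 * h \<Longrightarrow> S k \<subseteq> {F (x (2 * k + 2))<..F (x (2 * k))}"
    "\<And>k. k < 2 * h \<Longrightarrow> real h * sqrt (2 * real h) \<le> card (S k)" by metis
  have disj: "S k \<inter> S l = {}" if "k < l" "l < 2 * h" for k l
  proof -
    have "x (2 * k + 2) \<le> x (2 * l)" using x(2)[of "2 * k + 2" "2 * l"] that by (cases "Suc k = l") auto
    then have "F (x (2 * l)) \<le> F (x (2 * k + 2))"
      using F[of "x (2 * k + 2)" "x (2 * l)"] x(1)[of "2 * k + 2"] that by (cases "x (2 * k + 2) = x (2 * l)") auto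
    then show ?thesis using S(2)[of k] S(2)[of l] that by fastforce
  qed
  have "real (2 * h) * (real h * sqrt (2 * real h)) \<le> card ?Y"
  proof (rule card_ge_disjoint_parts)
    show "finite ?Y" using X Z by simp
    show "disjoint_family_on S {..<2 * h}"
      unfolding disjoint_family_on_def
    proof (intro ballI impI)
      fix k l assume "k \<in> {..<2 * h}" "l \<in> {..<2 * h}" "k \<noteq> l"
      then show "S k \<inter> S l = {}" using disj[of k l] disj[of l k] by (cases k l rule: linorder_cases) auto
    qed
  qed (use S in auto)
  then show ?thesis by simp
qed

section \<open>Dot products\<close>

lemma sum_inverse_squares_le:
  assumes "0 < t"
  shows "(\<Sum>m\<in>{t<..k}. 1 / real m ^ 2) \<le> 1 / real t"
proof -
  have "(\<Sum>m\<in>{t<..t + d}. 1 / real m ^ 2) \<le> 1 / real t - 1 / real (t + d)" for d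
  proof (induction d)
    case (Suc d)
    have "{t<..t + Suc d} = insert (t + Suc d) {t<..t + d}" by auto
    then have "(\<Sum>m\<in>{t<..t + Suc d}. 1 / real m ^ 2)
        = 1 / real (t + Suc d) ^ 2 + (\<Sum>m\<in>{t<..t + d}. 1 / real m ^ 2)" by simp
    moreover have "1 / (u + 1) ^ 2 \<le> 1 / u - 1 / (u + 1)" if "0 < u" for u :: real
    proof -
      have "1 / u - 1 / (u + 1) = 1 / (u * (u + 1))" using that by (simp add: field_simps)
      moreover have "u * (u + 1) \<le> (u + 1) ^ 2" using that by (simp add: power2_eq_square)
      then have "1 / (u + 1) ^ 2 \<le> 1 / (u * (u + 1))" using that by (intro divide_left_mono) auto
      ultimately show ?thesis by simp
    qed
    from this[of "real (t + d)"] have "1 / real (t + Suc d) ^ 2 \<le> 1 / real (t + d) - 1 / real (t + Suc d)"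
      using assms by (simp add: add.commute add.left_commute)
    ultimately show ?case using Suc by linarith
  qed simp
  from this[of "k - t"] show ?thesis
    by (cases "t \<le> k") (auto intro: order_trans)
qed

lemma sum_eq_sum_card_levels:
  fixes f :: "'a \<Rightarrow> nat"
  assumes "finite S" "\<And>x. x \<in> S \<Longrightarrow> f x \<le> K"
  shows "(\<Sum>x\<in>S. f x) = (\<Sum>m\<in>{0<..K}. card {x \<in> S. m \<le> f x})"
proof -
  have "(\<Sum>x\<in>S. f x) = (\<Sum>x\<in>S. card {m \<in> {0<..K}. m \<le> f x})"
  proof (rule sum.cong)
    fix x assume "x \<in> S"
    then have "{m \<in> {0<..K}. m \<le> f x} = {0<..f x}" using assms(2) by force
    then show "f x = card {m \<in> {0<..K}. m \<le> f x}" by simp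
  qed simp
  also have "\<dots> = (\<Sum>m\<in>{0<..K}. card {x \<in> S. m \<le> f x})"
    by (rule sum_multicount_gen) (use assms(1) in auto)
  finally show ?thesis .
qed

text \<open>Cut at \<open>t\<close>, about half the average richness. Levels up to \<open>t\<close>
  contribute at most \<open>N / 2\<close>, so the tail, controlled by \<open>levels\<close>, carries
  the rest. This bounds \<open>t\<close> from above, while \<open>card_S\<close> bounds it from
  below. If the average is below 2, \<open>card_S\<close> alone suffices.\<close>

lemma sum_bounded_by_levels:
  fixes f :: "'a \<Rightarrow> nat" and A B :: real
  assumes S: "finite S" "\<And>x. x \<in> S \<Longrightarrow> f x \<le> K" and N: "N = (\<Sum>x\<in>S. f x)"
    and levels: "\<And>m. 0 < m \<Longrightarrow> real (card {x \<in> S. m \<le> f x}) ^ 5 * real m ^ 14 \<le> A * real K ^ 16"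
    and card_S: "real (card S) * real N \<le> B * real K ^ 2"
    and A: "1 \<le> A" and B: "1 \<le> B" and K: "1 \<le> K"
  shows "real N ^ 23 \<le> 32 * A * (4 * B) ^ 23 * real K ^ 34"
proof (cases "N < 2 * card S")
  case True
  have "real N ^ 2 \<le> 2 * (real (card S) * real N)"
    using True mult_right_mono[of "real N" "2 * real (card S)" "real N"] by (simp add: power2_eq_square)
  also have "0 \<le> B * real K ^ 2" using B by simp
  then have "2 * (real (card S) * real N) \<le> 4 * B * real K ^ 2" using card_S by linarith
  also have "\<dots> \<le> (4 * B) ^ 2 * real K ^ 2"
    using B by (intro mult_right_mono) (auto simp: power2_eq_square)
  finally have "real N \<le> 4 * B * real K"
    unfolding power_mult_distrib[symmetric] by (rule power2_le_imp_le) (use B in auto)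
  then have "real N ^ 23 \<le> (4 * B * real K) ^ 23" by (intro power_mono) auto
  also have "\<dots> = 1 * (4 * B) ^ 23 * real K ^ 23" by (simp add: power_mult_distrib)
  also have "\<dots> \<le> (32 * A) * (4 * B) ^ 23 * real K ^ 34"
    using A B K by (intro mult_mono power_increasing) auto
  finally show ?thesis .
next
  case False
  show ?thesis
  proof (cases "card S = 0")
    case True
    then show ?thesis using S N A B by simp
  next
    case n0: False
    define n where "n = card S"
    define t where "t = N div (2 * n)"
    have n: "0 < n" using n0 by (simp add: n_def)
    have t: "0 < t" using False n by (simp add: t_def n_def div_greater_zero_iff)
    have t1: "2 * n * t \<le> N" by (simp add: t_def)
    have "N < 2 * n * (t + 1)"
      using n dividend_less_times_div[of "2 * n" N] by (simp add: t_def)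
    also have "\<dots> \<le> 4 * n * t" using t by simp
    finally have t2: "real N \<le> 4 * real n * real t"
      by (metis (no_types, opaque_lifting) less_imp_le of_nat_le_iff of_nat_mult of_nat_numeral)
    \<comment> \<open>Write \<open>m ^ 14\<close> as \<open>(m ^ 2) ^ 5 * m ^ 4\<close> and replace
      \<open>m ^ 4\<close> by the smaller \<open>t ^ 4\<close>: the fifth root is then a summable
      bound \<open>\<beta> / m ^ 2\<close>.\<close>
    define \<beta> where "\<beta> = root 5 (A * real K ^ 16 / real t ^ 4)"
    have \<beta>5: "\<beta> ^ 5 = A * real K ^ 16 / real t ^ 4" and \<beta>0: "0 \<le> \<beta>" using A by (simp_all add: \<beta>_def)
    let ?r = "\<lambda>m. real (card {x \<in> S. m \<le> f x})"
    have r: "?r m \<le> \<beta> * (1 / real m ^ 2)" if m: "t < m" for m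
    proof -
      have "(?r m * real m ^ 2) ^ 5 * real t ^ 4 \<le> (?r m * real m ^ 2) ^ 5 * real m ^ 4"
        using m by (intro mult_left_mono power_mono) auto
      also have "\<dots> = ?r m ^ 5 * real m ^ 14"
        by (simp add: power_mult_distrib flip: power_mult power_add)
      also have "\<dots> \<le> A * real K ^ 16" using levels m by simp
      finally have "(?r m * real m ^ 2) ^ 5 \<le> \<beta> ^ 5" using t by (simp add: \<beta>5 field_simps)
      then have "?r m * real m ^ 2 \<le> \<beta>"
        using power_mono_iff[of "?r m * real m ^ 2" \<beta> 5] \<beta>0 by simp
      then show ?thesis using m by (simp add: field_simps)
    qed
    have split: "{0<..K} = ({0<..K} \<inter> {..t}) \<union> {t<..K}" by auto
    have "real N = (\<Sum>m\<in>{0<..K}. ?r m)"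
      using sum_eq_sum_card_levels[OF S] N by simp
    also have "\<dots> = (\<Sum>m\<in>{0<..K} \<inter> {..t}. ?r m) + (\<Sum>m\<in>{t<..K}. ?r m)"
      by (subst split, rule sum.union_disjoint) auto
    also have "(\<Sum>m\<in>{0<..K} \<inter> {..t}. ?r m) \<le> real (card ({0<..K} \<inter> {..t})) * real n"
      by (rule sum_bounded_above) (use S in \<open>auto simp: n_def intro: card_mono\<close>)
    also have "\<dots> \<le> real t * real n"
    proof -
      have "card ({0<..K} \<inter> {..t}) \<le> card {0<..t}" by (intro card_mono) auto
      then show ?thesis by (intro mult_right_mono) auto
    qed
    also have "(\<Sum>m\<in>{t<..K}. ?r m) \<le> (\<Sum>m\<in>{t<..K}. \<beta> * (1 / real m ^ 2))"
      by (intro sum_mono r) simp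
    also have "\<dots> = \<beta> * (\<Sum>m\<in>{t<..K}. 1 / real m ^ 2)" by (simp add: sum_distrib_left)
    also have "\<dots> \<le> \<beta> * (1 / real t)" using sum_inverse_squares_le[OF t] \<beta>0 by (intro mult_left_mono) auto
    finally have "real N \<le> real t * real n + \<beta> / real t" by simp
    moreover have "2 * (real t * real n) \<le> real N"
      using t1 by (metis (no_types, opaque_lifting) mult.assoc mult.commute of_nat_le_iff of_nat_mult of_nat_numeral)
    ultimately have "real N \<le> 2 * (\<beta> / real t)" by linarith
    then have "real N * real t \<le> 2 * \<beta>" using t by (simp add: field_simps)
    then have "(real N * real t) ^ 5 \<le> (2 * \<beta>) ^ 5" by (intro power_mono) auto
    then have "(real N * real t) ^ 5 * real t ^ 4 \<le> 32 * (A * real K ^ 16 / real t ^ 4) * real t ^ 4"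
      by (intro mult_right_mono) (auto simp: power_mult_distrib \<beta>5)
    also have "\<dots> = 32 * (A * real K ^ 16)" using t by simp
    also have "(real N * real t) ^ 5 * real t ^ 4 = real N ^ 5 * real t ^ 9"
      by (simp add: power_mult_distrib flip: power_add)
    finally have b1: "real N ^ 5 * real t ^ 9 \<le> 32 * (A * real K ^ 16)" .
    have "real N ^ 2 \<le> 4 * (real n * real N) * real t"
      using mult_right_mono[OF t2, of "real N"] by (simp add: power2_eq_square mult_ac)
    also have "\<dots> \<le> 4 * (B * real K ^ 2) * real t"
      using card_S by (intro mult_right_mono mult_left_mono) (auto simp: n_def)
    \<comment> \<open>The ninth power matches the factor \<open>t ^ 9\<close> in \<open>b1\<close>,
      so that \<open>t\<close> can be eliminated; the exponents become 23 = 5 + 18 and 34 = 16 +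
      18.\<close>
    finally have "(real N ^ 2) ^ 9 \<le> (4 * (B * real K ^ 2) * real t) ^ 9" by (intro power_mono) auto
    also have "\<dots> = (4 * B) ^ 9 * real K ^ 18 * real t ^ 9"
      by (simp add: power_mult_distrib flip: power_mult)
    finally have b2: "real N ^ 18 \<le> (4 * B) ^ 9 * real K ^ 18 * real t ^ 9" by (simp flip: power_mult)
    have "real N ^ 23 = real N ^ 5 * real N ^ 18" by (simp flip: power_add)
    also have "\<dots> \<le> real N ^ 5 * ((4 * B) ^ 9 * real K ^ 18 * real t ^ 9)"
      using b2 by (intro mult_left_mono) auto
    also have "\<dots> = (4 * B) ^ 9 * real K ^ 18 * (real N ^ 5 * real t ^ 9)" by (simp add: mult_ac)
    also have "\<dots> \<le> (4 * B) ^ 9 * real K ^ 18 * (32 * (A * real K ^ 16))"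
      using b1 B by (intro mult_left_mono) auto
    also have "\<dots> = 32 * A * (4 * B) ^ 9 * (real K ^ 18 * real K ^ 16)" by (simp add: mult_ac)
    also have "\<dots> = 32 * A * (4 * B) ^ 9 * real K ^ 34" by (simp flip: power_add)
    also have "\<dots> \<le> 32 * A * (4 * B) ^ 23 * real K ^ 34"
      using A B by (intro mult_right_mono mult_left_mono power_increasing) auto
    finally show ?thesis .
  qed
qed

section \<open>Products of points in one quadrant\<close>

lemma ex_enumeration_real:
  fixes S :: "real set"
  assumes "finite S" "card S = Suc n"
  shows "\<exists>x. (\<forall>i j. i < j \<longrightarrow> j \<le> n \<longrightarrow> x i < x j) \<and> S = x ` {..n}"
proof -
  let ?l = "sorted_list_of_set S"
  have len: "length ?l = Suc n" using assms by simp
  have "?l ! i < ?l ! j" if "i < j" "j \<le> n" for i j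
    using strict_sorted_list_of_set[of S] len that by (simp add: sorted_wrt_iff_nth_less)
  moreover have "S = (!) ?l ` {..n}"
  proof -
    have "S = set ?l" using assms by simp
    also have "\<dots> = (!) ?l ` {..<length ?l}" by (auto simp: set_conv_nth)
    finally show ?thesis using len by (simp add: lessThan_Suc_atMost)
  qed
  ultimately show ?thesis by blast
qed

text \<open>The pair \<^term>\<open>(a, x)\<close> encodes the point \<^term>\<open>(a, a * x)\<close> of the plane.\<close>

locale slope_coordinates =
  fixes Q :: "(real \<times> real) set"
  assumes finite_Q: "finite Q"
    and scale_pos: "(a, x) \<in> Q \<Longrightarrow> 0 < a"
    and slope_nonneg: "(a, x) \<in> Q \<Longrightarrow> 0 \<le> x"
begin

definition dots where
  "dots = {a * b * (1 + x * y) | a x b y. (a, x) \<in> Q \<and> (b, y) \<in> Q \<and> (a, x) \<noteq> (b, y)}"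

definition fibre where "fibre x = {a. (a, x) \<in> Q}"

definition rich where "rich m = {x \<in> snd ` Q. m \<le> card (fibre x)}"

text \<open>The extra one leaves room for the product of a point with itself, and it makes
  \<open>K\<close> positive.\<close>

definition K where "K = Suc (card dots)"

lemma dotsI: "(a, x) \<in> Q \<Longrightarrow> (b, y) \<in> Q \<Longrightarrow> (a, x) \<noteq> (b, y) \<Longrightarrow> a * b * (1 + x * y) \<in> dots"
  unfolding dots_def by blast

lemma finite_dots: "finite dots"
proof -
  have "dots \<subseteq> (\<lambda>((a, x), (b, y)). a * b * (1 + x * y)) ` (Q \<times> Q)"
  proof
    fix d assume "d \<in> dots"
    then obtain a x b y where "(a, x) \<in> Q" "(b, y) \<in> Q" "d = a * b * (1 + x * y)"
      unfolding dots_def by blast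
    then show "d \<in> (\<lambda>((a, x), (b, y)). a * b * (1 + x * y)) ` (Q \<times> Q)"
      by (intro image_eqI[of _ _ "((a, x), (b, y))"]) auto
  qed
  then show ?thesis using finite_Q finite_subset by blast
qed

lemma finite_fibre: "finite (fibre x)"
proof -
  have "fibre x \<subseteq> fst ` Q" by (force simp: fibre_def)
  then show ?thesis using finite_Q finite_subset by blast
qed

lemma finite_rich: "finite (rich m)"
  using finite_Q by (simp add: rich_def)

lemma rich_nonneg: "x \<in> rich m \<Longrightarrow> 0 \<le> x"
  using slope_nonneg by (auto simp: rich_def)

text \<open>The coordinates of each point are swapped so that \<open>b\<close> times
  \<open>proj z\<close> is its inner product with the point encoded by
  \<open>(b, z)\<close>.\<close>

lemma card_projection_le:
  assumes z: "z \<in> snd ` Q"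
  shows "card (proj z ` (\<lambda>(a, x). (a * x, a)) ` Q) \<le> K"
proof -
  obtain b where b: "(b, z) \<in> Q" using z by auto
  have b0: "0 < b" using scale_pos[OF b] .
  let ?A = "proj z ` (\<lambda>(a, x). (a * x, a)) ` Q"
  have "(*) b ` ?A \<subseteq> insert (b * b * (1 + z * z)) dots"
  proof clarify
    fix a x assume ax: "(a, x) \<in> Q" and n: "b * proj z (a * x, a) \<notin> dots"
    have e: "b * proj z (a * x, a) = b * a * (1 + z * x)" by (simp add: proj_def algebra_simps)
    then have "(b, z) = (a, x)" using dotsI[OF b ax] n by metis
    then show "b * proj z (a * x, a) = b * b * (1 + z * z)" using e by simp
  qed
  then have "card ((*) b ` ?A) \<le> card (insert (b * b * (1 + z * z)) dots)"
    using finite_dots by (intro card_mono) auto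
  also have "\<dots> \<le> K" using finite_dots by (simp add: K_def card_insert_if)
  also have "card ((*) b ` ?A) = card ?A"
    by (rule card_image) (use b0 in \<open>auto intro!: inj_onI\<close>)
  finally show ?thesis .
qed

text \<open>The projection belonging to \<open>x\<close> itself separates the points on the line of
  slope \<open>x\<close>.\<close>

lemma card_fibre_le: "x \<in> snd ` Q \<Longrightarrow> card (fibre x) \<le> K"
proof -
  assume x: "x \<in> snd ` Q"
  have "(\<lambda>a. a * (1 + x * x)) ` fibre x \<subseteq> proj x ` (\<lambda>(a, x). (a * x, a)) ` Q"
  proof clarify
    fix a assume "a \<in> fibre x"
    then have "(a, x) \<in> Q" by (simp add: fibre_def)
    moreover have "a * (1 + x * x) = proj x (a * x, a)" by (simp add: proj_def algebra_simps)
    ultimately show "a * (1 + x * x) \<in> proj x ` (\<lambda>(a, x). (a * x, a)) ` Q" by force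
  qed
  then have "card ((\<lambda>a. a * (1 + x * x)) ` fibre x) \<le> card (proj x ` (\<lambda>(a, x). (a * x, a)) ` Q)"
    using finite_Q by (intro card_mono) auto
  moreover have "1 + x * x \<noteq> 0" by (smt (verit) zero_le_square)
  then have "card ((\<lambda>a. a * (1 + x * x)) ` fibre x) = card (fibre x)"
    by (intro card_image) (auto intro!: inj_onI)
  ultimately show ?thesis using card_projection_le[OF x] by simp
qed

lemma card_slopes_le:
  assumes "2 \<le> card (snd ` Q)" "2 * K \<le> card Q"
  shows "card (snd ` Q) * card Q \<le> 2304 * K ^ 2"
proof -
  let ?P = "(\<lambda>(a, x). (a * x, a)) ` Q"
  have "inj_on (\<lambda>(a, x). (a * x, a)) Q"
    using scale_pos by (force intro!: inj_onI)
  then have card: "card ?P = card Q" by (rule card_image)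
  have "card (snd ` Q) * card ?P \<le> 2304 * K ^ 2"
    by (rule few_projections) (use finite_Q card_projection_le assms card in auto)
  then show ?thesis using card by simp
qed

lemma card_Q_eq: "card Q = (\<Sum>x\<in>snd ` Q. card (fibre x))"
proof -
  have "Q = (\<lambda>(x, a). (a, x)) ` Sigma (snd ` Q) fibre"
    by (force simp: fibre_def)
  moreover have "inj_on (\<lambda>(x, a). (a, x)) (Sigma (snd ` Q) fibre)" by (auto intro!: inj_onI)
  ultimately have "card Q = card (Sigma (snd ` Q) fibre)" by (metis card_image)
  then show ?thesis using finite_Q finite_fibre by simp
qed

text \<open>Compare the two bounds for path products over two sets of \<open>4 * h + 1\<close> rich
  slopes. Squaring removes the root and turns the lower bound into \<open>8 * h ^ 5\<close>.\<close>

lemma card_rich_le_aux: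
  assumes m: "0 < m" and h: "0 < h" "8 * h + 2 \<le> card (rich m)"
  shows "8 * real h ^ 5 * real m ^ 14 \<le> real K ^ 16"
proof -
  obtain X where X: "X \<subseteq> rich m" "card X = Suc (4 * h)" "finite X"
    using obtain_subset_with_card_n[of "Suc (4 * h)" "rich m"] h by auto
  \<comment> \<open>\<open>Z\<close> is taken disjoint from \<open>X\<close>, so every factor along
    a path is a product of two distinct points.\<close>
  have "Suc (4 * h) \<le> card (rich m - X)"
    using X h finite_rich by (simp add: card_Diff_subset)
  then obtain Z where Z: "Z \<subseteq> rich m - X" "card Z = Suc (4 * h)" "finite Z"
    using obtain_subset_with_card_n by blast
  obtain x where x: "\<And>i j. i < j \<Longrightarrow> j \<le> 4 * h \<Longrightarrow> x i < x j" "X = x ` {..4 * h}"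
    using ex_enumeration_real[OF X(3,2)] by blast
  obtain w where w: "\<And>i j. i < j \<Longrightarrow> j \<le> 4 * h \<Longrightarrow> w i < w j" "Z = w ` {..4 * h}"
    using ex_enumeration_real[OF Z(3,2)] by blast
  have nonneg: "0 \<le> u" if "u \<in> X \<union> Z" for u using that X Z rich_nonneg by blast
  have "\<exists>f. inj_on f {..<m} \<and> f ` {..<m} \<subseteq> fibre u" if "u \<in> rich m" for u
  proof -
    have "m \<le> card (fibre u)" using that by (simp add: rich_def)
    then obtain T where T: "T \<subseteq> fibre u" "card T = m" "finite T" using obtain_subset_with_card_n by blast
    then obtain f where "bij_betw f {..<m} T" using ex_bij_betw_nat_finite[of T] by (auto simp: lessThan_atLeast0)
    then show ?thesis using T(1) by (auto simp: bij_betw_def)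
  qed
  then have "\<forall>u\<in>rich m. \<exists>f. inj_on f {..<m} \<and> f ` {..<m} \<subseteq> fibre u" by blast
  from bchoice[OF this] obtain \<alpha> where \<alpha>: "\<And>u. u \<in> rich m \<Longrightarrow> inj_on (\<alpha> u) {..<m} \<and> \<alpha> u ` {..<m} \<subseteq> fibre u"
    by blast
  have \<alpha>Q: "(\<alpha> u i, u) \<in> Q" if "u \<in> X \<union> Z" "i < m" for u i
  proof -
    have "u \<in> rich m" using that X Z by blast
    then have "\<alpha> u i \<in> fibre u" using \<alpha> that(2) by blast
    then show ?thesis by (simp add: fibre_def)
  qed
  let ?Y = "path_product (w 0) (w (4 * h)) ` (X \<times> Z \<times> X \<times> Z \<times> X \<times> Z \<times> X)"
  have up: "card ?Y * m ^ 7 \<le> card dots ^ 8"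
  proof (rule card_path_products_le[where \<alpha> = \<alpha>])
    show "inj_on (\<alpha> u) {..<m}" if "u \<in> X \<union> Z" for u using \<alpha> that X Z by blast
    show "0 < \<alpha> u i" if "u \<in> X \<union> Z" "i < m" for u i using scale_pos[OF \<alpha>Q[OF that]] .
    show "\<alpha> z i * \<alpha> v j * (1 + z * v) \<in> dots" if "v \<in> X" "z \<in> Z" "i < m" "j < m" for v z i j
    proof (rule dotsI)
      show "(\<alpha> z i, z) \<noteq> (\<alpha> v j, v)" using that(1,2) Z(1) by blast
    qed (use that \<alpha>Q in auto)
  qed (use X Z w(2) nonneg finite_dots m in auto)
  have low: "2 * real h * (real h * sqrt (2 * real h)) \<le> card ?Y"
    by (rule card_path_products_ge) (use x w h nonneg in auto)
  have "8 * real h ^ 5 = (2 * real h * (real h * sqrt (2 * real h))) ^ 2"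
    by (simp add: power_mult_distrib flip: power_add) (simp add: eval_nat_numeral)
  also have "\<dots> \<le> real (card ?Y) ^ 2" using low by (intro power_mono) auto
  finally have "8 * real h ^ 5 * real m ^ 14 \<le> real (card ?Y) ^ 2 * real m ^ 14"
    by (intro mult_right_mono) auto
  also have "\<dots> = real (card ?Y * m ^ 7) ^ 2" by (simp add: power_mult_distrib flip: power_mult)
  also have "\<dots> \<le> real (card dots ^ 8) ^ 2" using up by (intro power_mono of_nat_mono) auto
  also have "\<dots> \<le> real K ^ 16" by (simp add: K_def power_mono flip: power_mult)
  finally show ?thesis .
qed

lemma card_rich_le:
  assumes m: "0 < m"
  shows "real (card (rich m)) ^ 5 * real m ^ 14 \<le> 20 ^ 5 * real K ^ 16"
proof (cases "card (rich m) < 10")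
  case True
  show ?thesis
  proof (cases "rich m = {}")
    case False
    then obtain u where "u \<in> rich m" by blast
    then have "m \<le> K" using card_fibre_le[of u] by (simp add: rich_def)
    then have "real (card (rich m)) ^ 5 * real m ^ 14 \<le> 20 ^ 5 * real K ^ 14"
      using True by (intro mult_mono power_mono) auto
    also have "\<dots> \<le> 20 ^ 5 * real K ^ 16"
      by (intro mult_left_mono power_increasing) (auto simp: K_def)
    finally show ?thesis .
  qed simp
next
  case False
  \<comment> \<open>As \<open>h\<close> is positive, \<open>8 * h + 2\<close> is at most
    \<open>10 * h\<close>, and the remainder of the division is below \<open>10 * h\<close>.\<close>
  define h where "h = card (rich m) div 10"
  have h: "0 < h" "8 * h + 2 \<le> card (rich m)" "card (rich m) \<le> 20 * h"
    using False unfolding h_def by presburger+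
  have "real (card (rich m)) ^ 5 * real m ^ 14 \<le> (20 * real h) ^ 5 * real m ^ 14"
    using h(3) by (intro mult_right_mono power_mono) auto
  also have "\<dots> \<le> 20 ^ 5 * (8 * real h ^ 5 * real m ^ 14)" by (simp add: power_mult_distrib)
  also have "\<dots> \<le> 20 ^ 5 * real K ^ 16"
    using card_rich_le_aux[OF m h(1,2)] by (intro mult_left_mono) auto
  finally show ?thesis .
qed

theorem card_le_dots:
  "real (card Q) ^ 23 \<le> 32 * 20 ^ 5 * (4 * 2304) ^ 23 * real (Suc (card dots)) ^ 34"
proof (cases "2 \<le> card (snd ` Q) \<and> 2 * K \<le> card Q")
  case True
  have "real (card Q) ^ 23 \<le> 32 * (20 ^ 5) * (4 * 2304) ^ 23 * real K ^ 34"
  proof (rule sum_bounded_by_levels[where S = "snd ` Q" and f = "\<lambda>x. card (fibre x)"])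
    have "card (snd ` Q) * card Q \<le> 2304 * K ^ 2" using card_slopes_le True by blast
    then have "real (card (snd ` Q) * card Q) \<le> real (2304 * K ^ 2)" by (simp only: of_nat_le_iff)
    then show "real (card (snd ` Q)) * real (card Q) \<le> 2304 * real K ^ 2" by simp
    show "real (card {x \<in> snd ` Q. m \<le> card (fibre x)}) ^ 5 * real m ^ 14 \<le> 20 ^ 5 * real K ^ 16"
      if "0 < m" for m using card_rich_le[OF that] by (simp add: rich_def)
  qed (use finite_Q card_fibre_le card_Q_eq in \<open>auto simp: K_def\<close>)
  then show ?thesis by (simp add: K_def)
next
  case False
  \<comment> \<open>Otherwise all points share one slope, and the bound on a single fibre
    applies.\<close>
  have "card Q \<le> 2 * K"
  proof (cases "2 * K \<le> card Q")
    case True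
    then have "card (snd ` Q) \<le> 1" using False by simp
    moreover have "(\<Sum>x\<in>snd ` Q. card (fibre x)) \<le> card (snd ` Q) * K"
      using sum_bounded_above[of "snd ` Q" "\<lambda>x. card (fibre x)" K] card_fibre_le by simp
    ultimately show ?thesis using card_Q_eq mult_right_mono[of "card (snd ` Q)" 1 K] by linarith
  qed simp
  then have "real (card Q) ^ 23 \<le> (2 * real K) ^ 23" by (intro power_mono) auto
  also have "\<dots> = 2 ^ 23 * real K ^ 23" by (simp add: power_mult_distrib)
  also have "\<dots> \<le> (32 * 20 ^ 5 * (4 * 2304) ^ 23) * real K ^ 34"
    by (intro mult_mono power_increasing) (auto simp: K_def)
  finally show ?thesis by (simp add: K_def)
qed

end

section \<open>From quadrants to the plane\<close>

definition dot_products :: "(real ^ 2) set \<Rightarrow> real set" where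
  "dot_products P = {p \<bullet> q | p q. p \<in> P \<and> q \<in> P \<and> p \<noteq> q}"

lemma finite_dot_products: "finite P \<Longrightarrow> finite (dot_products P)"
  by (rule finite_subset[of _ "(\<lambda>(p, q). p \<bullet> q) ` (P \<times> P)"]) (auto simp: dot_products_def)

text \<open>The rotation with cosine \<open>c\<close> and sine \<open>s\<close> turns the sector
  into the standard quadrant and preserves inner products; \<open>u\<close> and \<open>v\<close> are
  the rotated coordinates.\<close>

lemma card_sector_le:
  fixes P :: "(real ^ 2) set" and c s :: real
  assumes P: "finite P" and cs: "c ^ 2 + s ^ 2 = 1"
  defines "T \<equiv> {p \<in> P. 0 < c * p $ 1 + s * p $ 2 \<and> 0 \<le> c * p $ 2 - s * p $ 1}"
  shows "real (card T) ^ 23 \<le> 32 * 20 ^ 5 * (4 * 2304) ^ 23 * real (Suc (card (dot_products P))) ^ 34"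
proof -
  define u v where "u = (\<lambda>p :: real ^ 2. c * p $ 1 + s * p $ 2)" and "v = (\<lambda>p :: real ^ 2. c * p $ 2 - s * p $ 1)"
  let ?\<phi> = "\<lambda>p. (u p, v p / u p)"
  have T: "p \<in> P" "0 < u p" "0 \<le> v p" if "p \<in> T" for p using that by (auto simp: T_def u_def v_def)
  have recover: "p $ 1 = c * u p - s * v p" "p $ 2 = s * u p + c * v p" for p
  proof -
    have "c * u p - s * v p = (c ^ 2 + s ^ 2) * p $ 1" "s * u p + c * v p = (c ^ 2 + s ^ 2) * p $ 2"
      unfolding u_def v_def by algebra+
    then show "p $ 1 = c * u p - s * v p" "p $ 2 = s * u p + c * v p" using cs by simp_all
  qed
  have inner: "p \<bullet> q = u p * u q + v p * v q" for p q
  proof -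
    have "u p * u q + v p * v q = (c ^ 2 + s ^ 2) * (p $ 1 * q $ 1 + p $ 2 * q $ 2)"
      unfolding u_def v_def by algebra
    then show ?thesis using cs by (simp add: inner_vec_def sum_2)
  qed
  have "inj_on ?\<phi> T"
  proof (rule inj_onI)
    fix p q assume pq: "p \<in> T" "q \<in> T" "?\<phi> p = ?\<phi> q"
    then have "u p = u q" "v p = v q" using T(2)[of p] T(2)[of q] by auto
    then show "p = q" using recover[of p] recover[of q] by (simp add: vec_eq_iff forall_2)
  qed
  then have card: "card (?\<phi> ` T) = card T" by (rule card_image)
  have "finite T" using P by (simp add: T_def)
  interpret slope_coordinates "?\<phi> ` T"
    by unfold_locales (use \<open>finite T\<close> T in \<open>auto intro!: divide_nonneg_pos\<close>)
  have "dots \<subseteq> dot_products P"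
  proof
    fix d assume "d \<in> dots"
    then obtain p q where pq: "p \<in> T" "q \<in> T" "?\<phi> p \<noteq> ?\<phi> q"
      and d: "d = u p * u q * (1 + v p / u p * (v q / u q))"
      unfolding dots_def by blast
    have "d = p \<bullet> q" using T(2)[OF pq(1)] T(2)[OF pq(2)] by (simp add: d inner field_simps)
    then show "d \<in> dot_products P" unfolding dot_products_def using pq T(1) by blast
  qed
  then have "Suc (card dots) \<le> Suc (card (dot_products P))"
    using finite_dot_products[OF P] by (simp add: card_mono)
  then have "real (Suc (card dots)) ^ 34 \<le> real (Suc (card (dot_products P))) ^ 34"
    by (intro power_mono) auto
  then have "32 * 20 ^ 5 * (4 * 2304) ^ 23 * real (Suc (card dots)) ^ 34
      \<le> 32 * 20 ^ 5 * (4 * 2304) ^ 23 * real (Suc (card (dot_products P))) ^ 34"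
    by (intro mult_left_mono) auto
  then show ?thesis using card_le_dots unfolding card by linarith
qed

lemma card_pow_le_dot_products:
  fixes P :: "(real ^ 2) set"
  assumes P: "finite P" "2 \<le> card P"
  shows "real (card P) ^ 23 \<le> 8 ^ 23 * (32 * 20 ^ 5 * (4 * 2304) ^ 23 * 2 ^ 34) * real (card (dot_products P)) ^ 34"
proof -
  \<comment> \<open>The four rotated copies of \<open>{x > 0, y \<ge> 0}\<close> partition the plane without the origin.\<close>
  define T where "T = (\<lambda>(c, s). {p \<in> P. 0 < c * p $ 1 + s * p $ 2 \<and> 0 \<le> c * p $ 2 - s * p $ 1})"
  define A where "A = {(1 :: real, 0), (0, 1), (-1, 0), (0, -1 :: real)}"
  have "P \<subseteq> insert 0 (\<Union>a\<in>A. T a)"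
  proof
    fix p assume "p \<in> P"
    then show "p \<in> insert 0 (\<Union>a\<in>A. T a)"
      by (auto simp: A_def T_def vec_eq_iff forall_2)
  qed
  then have "card P \<le> card (insert 0 (\<Union>a\<in>A. T a))"
    by (rule card_mono[rotated]) (use P in \<open>auto simp: A_def T_def\<close>)
  also have "\<dots> \<le> Suc (card (\<Union>a\<in>A. T a))" by (rule card_insert_le_m1) auto
  also have "\<dots> \<le> Suc (\<Sum>a\<in>A. card (T a))"
    using card_UN_le[of A T] by (simp add: A_def)
  finally have le: "card P \<le> Suc (\<Sum>a\<in>A. card (T a))" .
  \<comment> \<open>Four sectors with fewer than \<open>card P / 8\<close> points each, plus the
    origin, would give \<open>card P < 2\<close>.\<close>
  have "\<exists>a\<in>A. card P \<le> 8 * card (T a)"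
  proof (rule ccontr)
    assume "\<not> ?thesis"
    then have "8 * card (T a) < card P" if "a \<in> A" for a using that by force
    then have "\<forall>a\<in>{(1, 0), (0, 1), (-1, 0), (0, -1)}. 8 * card (T a) < card P" by (simp add: A_def)
    then show False using le P(2) by (simp add: A_def)
  qed
  then obtain a where a: "a \<in> A" "card P \<le> 8 * card (T a)" by blast
  obtain c s where cs: "a = (c, s)" "c ^ 2 + s ^ 2 = 1" using a(1) by (auto simp: A_def)
  \<comment> \<open>Two distinct points make the product set nonempty, so its cardinality plus one
    is at most twice its cardinality.\<close>
  obtain p q where pq: "p \<in> P" "q \<in> P" "p \<noteq> q"
    using P card_le_Suc0_iff_eq[of P] by auto
  then have "p \<bullet> q \<in> dot_products P" unfolding dot_products_def by blast
  then have "0 < card (dot_products P)" using finite_dot_products[OF P(1)] by (auto simp: card_gt_0_iff)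
  then have d: "real (Suc (card (dot_products P))) \<le> 2 * real (card (dot_products P))" by simp
  have "real (card P) ^ 23 \<le> (8 * real (card (T a))) ^ 23"
    using a(2) by (intro power_mono) auto
  also have "\<dots> = 8 ^ 23 * real (card (T a)) ^ 23" by (rule power_mult_distrib)
  also have "\<dots> \<le> 8 ^ 23 * (32 * 20 ^ 5 * (4 * 2304) ^ 23 * real (Suc (card (dot_products P))) ^ 34)"
    using card_sector_le[OF P(1) cs(2)] unfolding T_def cs(1) prod.case by (intro mult_left_mono) auto
  also have "\<dots> \<le> 8 ^ 23 * (32 * 20 ^ 5 * (4 * 2304) ^ 23 * (2 * real (card (dot_products P))) ^ 34)"
    using d by (intro mult_left_mono power_mono) auto
  also have "\<dots> = 8 ^ 23 * (32 * 20 ^ 5 * (4 * 2304) ^ 23 * 2 ^ 34) * real (card (dot_products P)) ^ 34"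
    unfolding power_mult_distrib[of 2 "real (card (dot_products P))"] by (simp only: mult.assoc)
  finally show ?thesis .
qed

theorem mainTheorem8:
  "\<exists>c::real. c > 0 \<and>
     (\<forall>P :: (real ^ 2) set. finite P \<and> card P \<ge> 2 \<longrightarrow>
        real (card {p \<bullet> q | p q. p \<in> P \<and> q \<in> P \<and> p \<noteq> q})
          \<ge> c * real (card P) powr (199 / 295))"
proof -
  define C :: real where "C = 8 ^ 23 * (32 * 20 ^ 5 * (4 * 2304) ^ 23 * 2 ^ 34)"
  have C: "0 < C" by (simp add: C_def)
  \<comment> \<open>The constant comes from taking 34th roots; since 199/295 < 23/34 and
    \<open>card P\<close> is at least 1, the exponent may then be lowered.\<close>
  define c where "c = (1 / C) powr (1 / 34)"
  have "c * real (card P) powr (199 / 295) \<le> real (card (dot_products P))"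
    if P: "finite P" "2 \<le> card P" for P :: "(real ^ 2) set"
  proof -
    let ?N = "real (card P)" and ?d = "real (card (dot_products P))"
    have "c * ?N powr (199 / 295) \<le> c * ?N powr (23 / 34)"
      using P(2) by (intro mult_left_mono powr_mono) (auto simp: c_def)
    also have "\<dots> = (1 / C * ?N ^ 23) powr (1 / 34)"
    proof -
      have "?N powr (23 / 34) = (?N powr 23) powr (1 / 34)" by (subst powr_powr) simp
      also have "?N powr 23 = ?N ^ 23" using P(2) powr_realpow[of ?N 23] by simp
      finally show ?thesis
        using C powr_mult[of "1 / C" "?N ^ 23" "1 / 34"] by (simp only: c_def)
    qed
    also have "\<dots> \<le> (?d ^ 34) powr (1 / 34)"
      using card_pow_le_dot_products[OF P, folded C_def] C
      by (intro powr_mono2) (auto simp: field_simps)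
    also have "\<dots> = ?d"
    proof (cases "?d = 0")
      case False
      then show ?thesis using powr_realpow[of ?d 34] powr_powr[of ?d 34 "1 / 34"] by simp
    qed simp
    finally show ?thesis .
  qed
  moreover have "0 < c" using C by (simp add: c_def)
  ultimately show ?thesis unfolding dot_products_def by blast
qed

end
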